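(* Let $\varepsilon\in(0,1)$, let $F,F_0$ be distribution functions of probability measures on $[0,\infty)$ with $F_0\prec F$, and assume $\mathbb{E}Y_F<\infty$ and $\mathbb{E}Y_{F_0}<\infty$. Then $$\lim_{n\to\infty}\frac{T_\eta(0,n\mathbf e_2)}{n}=\mu_{F_0}(\mathbf e_2)\quad\text{with } (\mathbf P_\varepsilon\times\mathbb P)\text{-probability one}.$$
   Context: Let $\mathbf P_\varepsilon$ be the product measure on $\{0,1\}^{\mathbb{Z}}$ under which each coordinate $\eta_x$ equals $1$ with probability $\varepsilon$. Independently, let $(\xi_e)_{e\in\mathcal E}$ be i.i.d. uniform on $[0,1]$ indexed by nearest-neighbour edges of $\mathbb{Z}^2$, with law $\mathbb P$. For a distribution function $G$, $G^{-1}(u)=\min\{x:G(x)\ge u\}$. Given $\eta$, each vertical edge $e=\{(x,y),(x,y+1)\}$ gets weight $\tau_e=F^{-1}(\xi_e)$ if $\eta_x=0$ and $F_0^{-1}(\xi_e)$ if $\eta_x=1$; each horizontal edge $e=\{(x,y),(x+1,y)\}$ gets $F_0^{-1}(\xi_e)$ if $\eta_x=\eta_{x+1}=1$ and $F^{-1}(\xi_e)$ otherwise. $T_\eta(u,v)$ is the infimum over nearest-neighbour paths from $u$ to $v$ of the sum of these weights. For a distribution $G$, $Y_G$ is the minimum of four i.i.d. $G$ variables and $\mu_G(x)$ is the time constant of homogeneous first-passage percolation with i.i.d. $G$ weights (the limit in probability of $T_G(0,nx)/n$). $F_0\prec F$ means $\int\phi\,dF_0\le\int\phi\,dF$ for every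 concave non-decreasing $\phi:\mathbb{R}\to\mathbb{R}$ for which both integrals converge absolutely. $\mathbf e_2=(0,1)$. *)

theory Defs
  imports "HOL-Probability.Probability"
begin

(* Vertices of Z^2 are pairs of integers.  A nearest-neighbour edge is encoded by
   its lower/left endpoint and an orientation flag:
     ((x,y), False) = horizontal edge {(x,y),(x+1,y)},
     ((x,y), True)  = vertical edge   {(x,y),(x,y+1)}.
   This is a bijection with the set of nearest-neighbour edges of Z^2. *)
type_synonym vertex = "int \<times> int"
type_synonym edge = "vertex \<times> bool"

definition nn_adj :: "vertex \<Rightarrow> vertex \<Rightarrow> bool" where
  "nn_adj a b \<longleftrightarrow> \<bar>fst a - fst b\<bar> + \<bar>snd a - snd b\<bar> = 1"

definition nn_edge :: "vertex \<Rightarrow> vertex \<Rightarrow> edge" where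
  "nn_edge a b =
     (if snd a = snd b then ((min (fst a) (fst b), snd a), False)
      else ((fst a, min (snd a) (snd b)), True))"

definition is_path :: "vertex \<Rightarrow> vertex \<Rightarrow> vertex list \<Rightarrow> bool" where
  "is_path u v p \<longleftrightarrow> p \<noteq> [] \<and> hd p = u \<and> last p = v \<and>
     (\<forall>i. Suc i < length p \<longrightarrow> nn_adj (p ! i) (p ! Suc i))"

definition path_weight :: "(edge \<Rightarrow> real) \<Rightarrow> vertex list \<Rightarrow> real" where
  "path_weight \<tau> p = (\<Sum>i<length p - 1. \<tau> (nn_edge (p ! i) (p ! Suc i)))"

definition passage_time :: "(edge \<Rightarrow> real) \<Rightarrow> vertex \<Rightarrow> vertex \<Rightarrow> real" where
  "passage_time \<tau> u v = Inf (path_weight \<tau> ` {p. is_path u v p})"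

definition quantile :: "(real \<Rightarrow> real) \<Rightarrow> real \<Rightarrow> real" where
  "quantile G u = Inf {x. G x \<ge> u}"

(* law of eta: product Bernoulli(eps) on {0,1}^Z, with True meaning eta_x = 1 *)
definition env_measure :: "real \<Rightarrow> (int \<Rightarrow> bool) measure" where
  "env_measure \<epsilon> = PiM UNIV (\<lambda>_. measure_pmf (bernoulli_pmf \<epsilon>))"

definition edge_measure :: "(edge \<Rightarrow> real) measure" where
  "edge_measure = PiM UNIV (\<lambda>_. uniform_measure lborel {0..1})"

definition env_weights ::
  "(real \<Rightarrow> real) \<Rightarrow> (real \<Rightarrow> real) \<Rightarrow> (int \<Rightarrow> bool) \<Rightarrow> (edge \<Rightarrow> real) \<Rightarrow> edge \<Rightarrow> real" where
  "env_weights F F0 \<eta> \<xi> e =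
     (case e of ((x, y), True) \<Rightarrow>
          (if \<eta> x then quantile F0 (\<xi> e) else quantile F (\<xi> e))
      | ((x, y), False) \<Rightarrow>
          (if \<eta> x \<and> \<eta> (x + 1) then quantile F0 (\<xi> e) else quantile F (\<xi> e)))"

definition T_env ::
  "(real \<Rightarrow> real) \<Rightarrow> (real \<Rightarrow> real) \<Rightarrow> (int \<Rightarrow> bool) \<Rightarrow> (edge \<Rightarrow> real) \<Rightarrow> vertex \<Rightarrow> vertex \<Rightarrow> real" where
  "T_env F F0 \<eta> \<xi> u v = passage_time (env_weights F F0 \<eta> \<xi>) u v"

definition T_hom :: "(real \<Rightarrow> real) \<Rightarrow> (edge \<Rightarrow> real) \<Rightarrow> vertex \<Rightarrow> vertex \<Rightarrow> real" where
  "T_hom G \<xi> u v = passage_time (\<lambda>e. quantile G (\<xi> e)) u v"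

definition time_constant :: "(real \<Rightarrow> real) \<Rightarrow> vertex \<Rightarrow> real" where
  "time_constant G x = (THE c. \<forall>\<delta>>0.
     (\<lambda>n::nat. measure edge_measure
        {\<xi> \<in> space edge_measure.
           \<bar>T_hom G \<xi> (0, 0) (int n * fst x, int n * snd x) / real n - c\<bar> > \<delta>})
     \<longlonglongrightarrow> 0)"

definition finite_EY :: "real measure \<Rightarrow> bool" where
  "finite_EY \<nu> \<longleftrightarrow>
     (\<integral>\<^sup>+ z. ennreal (min (min (z 0) (z 1)) (min (z 2) (z 3)))
        \<partial>(PiM {0..<4::nat} (\<lambda>_. \<nu>))) < \<infinity>"

definition conc_dom :: "real measure \<Rightarrow> real measure \<Rightarrow> bool" where
  "conc_dom \<nu>0 \<nu> \<longleftrightarrow>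
     (\<forall>\<phi>::real \<Rightarrow> real. concave_on UNIV \<phi> \<and> mono \<phi> \<and>
        integrable \<nu>0 \<phi> \<and> integrable \<nu> \<phi> \<longrightarrow>
        (\<integral>x. \<phi> x \<partial>\<nu>0) \<le> (\<integral>x. \<phi> x \<partial>\<nu>))"

end

theory Submission
  imports Defs
begin

text \<open>
  Fix \<open>\<eta>\<close>. The weights depend on the column only, so vertical shifts preserve the law of
  \<open>\<xi>\<close>, and \<open>T\<^sub>\<eta>\<close> between points of one column is a stationary subadditive process. It is
  integrable because neighbours are joined by four edge-disjoint paths, and a change of
  one edge moves it by a bounded amount, so \<open>liminf T\<^sub>\<eta>(0, n e\<^sub>2) / n\<close> is deterministic by a
  zero-one law; Steele's covering argument shows that it is at least \<open>inf\<^sub>n E T\<^sub>\<eta>(0, n e\<^sub>2) / n\<close>.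
  As a minimum of affine functions, the passage time over a finite set of paths is concave and
  non-decreasing in each weight, so replacing the \<open>F\<close> weights by \<open>F\<^sub>0\<close> weights one edge at a
  time does not increase its expectation. Hence the lower bound is at least the corresponding
  quantity \<open>\<mu>\<close> of the homogeneous \<open>F\<^sub>0\<close> medium.

  Conversely \<open>\<mu>\<close> is approximated by the normalised expected minimal weight \<open>E f / k\<close> over a
  finite set of paths from \<open>0\<close> to \<open>k e\<^sub>2\<close>. Almost every \<open>\<eta>\<close> has a run of ones wide enough to
  contain a translate of these paths; going to that run, following it upwards block by block,
  and returning costs \<open>(E f / k + o(1)) n\<close>, by the same covering argument applied to \<open>- f\<close> and
  by Borel--Cantelli for the return. The case \<open>\<eta> \<equiv> 1\<close> identifies \<open>\<mu>\<close> with the time constant.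
\<close>

section \<open>Zero-one law and subadditive processes on product spaces\<close>

lemma PiM_UNIV_resample:
  assumes "\<And>i. prob_space (M i)"
  shows "distr (M i \<Otimes>\<^sub>M PiM UNIV M) (PiM UNIV M) (\<lambda>(x, X). X(i := x)) = PiM UNIV M"
  using distr_pair_PiM_eq_PiM[of UNIV M i] assms by simp

lemma measurable_PiM_UNIV_upd:
  "(\<lambda>(x, X). X(i := x)) \<in> measurable (M i \<Otimes>\<^sub>M PiM UNIV M) (PiM UNIV M)"
  using measurable_fun_upd[where I = UNIV and J = UNIV and M = M and i = i and
      N = "M i \<Otimes>\<^sub>M PiM UNIV M" and f = snd and h = fst]
  by (simp add: split_beta')

text \<open>Tonelli for a fresh value of coordinate \<open>i\<close>. It serves the zero-one law
  and, later, the replacement of edge weights one edge at a time.\<close>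

lemma nn_integral_PiM_resample:
  assumes M: "\<And>i. prob_space (M i)" and f: "f \<in> borel_measurable (PiM UNIV M)"
  shows "(\<integral>\<^sup>+X. f X \<partial>PiM UNIV M) = (\<integral>\<^sup>+X. \<integral>\<^sup>+x. f (X(i := x)) \<partial>M i \<partial>PiM UNIV M)"
proof -
  interpret Mi: prob_space "M i" by (rule M)
  interpret P: prob_space "PiM UNIV M" by (intro prob_space_PiM M)
  interpret pair_sigma_finite "M i" "PiM UNIV M" by unfold_locales
  note [measurable] = f measurable_PiM_UNIV_upd[of i M]
  have m: "(\<lambda>(x, X). f (X(i := x))) \<in> borel_measurable (M i \<Otimes>\<^sub>M PiM UNIV M)"
    using measurable_compose[OF measurable_PiM_UNIV_upd f] by (simp add: split_beta')
  have "(\<integral>\<^sup>+X. f X \<partial>PiM UNIV M) = (\<integral>\<^sup>+z. f ((\<lambda>(x, X). X(i := x)) z) \<partial>(M i \<Otimes>\<^sub>M PiM UNIV M))"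
    using nn_integral_distr[OF measurable_PiM_UNIV_upd[of i M], of f] f by (simp add: PiM_UNIV_resample M)
  also have "\<dots> = (\<integral>\<^sup>+X. \<integral>\<^sup>+x. f (X(i := x)) \<partial>M i \<partial>PiM UNIV M)"
    using nn_integral_snd[OF m] by (simp add: split_beta')
  finally show ?thesis .
qed

text \<open>An event that ignores each single coordinate is independent of every cylinder. Cylinders
  determine a finite measure on the product, so \<open>A\<close> is independent of itself and its
  probability solves p = p * p.\<close>

lemma PiM_zero_one_law:
  fixes M :: "'i \<Rightarrow> 'a measure"
  assumes M: "\<And>i. prob_space (M i)" and A: "A \<in> sets (PiM UNIV M)"
    and inv: "\<And>X i x. X \<in> space (PiM UNIV M) \<Longrightarrow> x \<in> space (M i) \<Longrightarrow> X(i := x) \<in> A \<longleftrightarrow> X \<in> A"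
  shows "(AE X in PiM UNIV M. X \<in> A) \<or> (AE X in PiM UNIV M. X \<notin> A)"
proof -
  let ?P = "PiM UNIV M"
  interpret P: prob_space ?P by (intro prob_space_PiM M)
  \<comment> \<open>Resampling a constrained coordinate \<open>i\<close> splits off the factor of
    \<open>E i\<close>: neither \<open>indicator A\<close> nor the remaining factors see the new
    value.\<close>
  have cyl: "(\<integral>\<^sup>+X. indicator A X * (\<Prod>j\<in>J. indicator (E j) (X j)) \<partial>?P) = emeasure ?P A * (\<Prod>j\<in>J. emeasure (M j) (E j))"
    if "finite J" "\<And>j. j \<in> J \<Longrightarrow> E j \<in> sets (M j)" for J and E :: "'i \<Rightarrow> 'a set"
    using that
  proof (induction J)
    case empty
    then show ?case using A by simp
  next
    case (insert i J)
    have [measurable]: "A \<in> sets ?P" "\<And>j. j \<in> J \<Longrightarrow> E j \<in> sets (M j)" "E i \<in> sets (M i)"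
      using A insert by auto
    have E: "(\<lambda>X. indicator (E j) (X j) :: ennreal) \<in> borel_measurable ?P" if "j \<in> insert i J" for j
      using insert.prems[OF that] by (intro measurable_compose[OF measurable_component_singleton]) auto
    interpret Mi: prob_space "M i" by (rule M)
    let ?f = "\<lambda>X. indicator A X * (\<Prod>j\<in>J. indicator (E j) (X j)) :: ennreal"
    have "(\<integral>\<^sup>+X. indicator A X * (\<Prod>j\<in>insert i J. indicator (E j) (X j)) \<partial>?P)
        = (\<integral>\<^sup>+X. \<integral>\<^sup>+x. indicator A (X(i := x)) * (\<Prod>j\<in>insert i J. indicator (E j) ((X(i := x)) j)) \<partial>M i \<partial>?P)"
      using E by (intro nn_integral_PiM_resample M borel_measurable_times_ennreal borel_measurable_prod_ennreal) auto
    also have "\<dots> = (\<integral>\<^sup>+X. \<integral>\<^sup>+x. ?f X * indicator (E i) x \<partial>M i \<partial>?P)"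
    proof (intro nn_integral_cong)
      fix X x assume "X \<in> space ?P" "x \<in> space (M i)"
      then have "indicator A (X(i := x)) = (indicator A X :: ennreal)"
        using inv by (simp add: indicator_def)
      moreover have "(\<Prod>j\<in>J. indicator (E j) ((X(i := x)) j)) = (\<Prod>j\<in>J. indicator (E j) (X j) :: ennreal)"
        using insert by (intro prod.cong) auto
      ultimately show "indicator A (X(i := x)) * (\<Prod>j\<in>insert i J. indicator (E j) ((X(i := x)) j)) = ?f X * indicator (E i) x"
        using insert by (simp add: mult_ac)
    qed
    also have "\<dots> = (\<integral>\<^sup>+X. ?f X * emeasure (M i) (E i) \<partial>?P)"
      by (intro nn_integral_cong) (simp add: nn_integral_cmult)
    also have "\<dots> = (\<integral>\<^sup>+X. ?f X \<partial>?P) * emeasure (M i) (E i)"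
      by (rule nn_integral_multc) (use E in \<open>auto intro!: borel_measurable_times_ennreal borel_measurable_prod_ennreal\<close>)
    finally show ?case
      using insert by (simp add: mult_ac)
  qed
  \<comment> \<open>By \<open>cyl\<close>, the restriction of the measure to \<open>A\<close> and
    its multiple by the mass of \<open>A\<close> agree on all cylinders.\<close>
  have "density ?P (indicator A) = density ?P (\<lambda>_. emeasure ?P A)"
  proof (rule measure_eqI_PiM_infinite)
    show "finite_measure (density ?P (indicator A))"
      using A by (intro finite_measureI) (simp add: emeasure_density)
    fix J and E :: "'i \<Rightarrow> 'a set"
    assume J: "finite J" "J \<subseteq> UNIV" "\<And>i. i \<in> J \<Longrightarrow> E i \<in> sets (M i)"
    let ?X = "prod_emb UNIV M J (Pi\<^sub>E J E)"
    have X: "?X \<in> sets ?P"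
      using J by (intro sets_PiM_I) auto
    have ind: "indicator ?X X = (\<Prod>j\<in>J. indicator (E j) (X j) :: ennreal)" if "X \<in> space ?P" for X
    proof -
      have "X \<in> ?X \<longleftrightarrow> (\<forall>j\<in>J. X j \<in> E j)"
        using that J by (auto simp: prod_emb_def space_PiM PiE_iff)
      then show ?thesis
        using J(1) by (auto simp: indicator_def prod_zero_iff)
    qed
    have "emeasure (density ?P (indicator A)) ?X = (\<integral>\<^sup>+X. indicator A X * (\<Prod>j\<in>J. indicator (E j) (X j)) \<partial>?P)"
      using A X ind by (simp add: emeasure_density cong: nn_integral_cong)
    also have "\<dots> = emeasure ?P A * emeasure ?P ?X"
      using J M by (simp add: cyl emeasure_PiM_emb)
    also have "\<dots> = emeasure (density ?P (\<lambda>_. emeasure ?P A)) ?X"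
      using X by (simp add: emeasure_density nn_integral_cmult)
    finally show "emeasure (density ?P (indicator A)) ?X = emeasure (density ?P (\<lambda>_. emeasure ?P A)) ?X" .
  qed auto
  then have "emeasure (density ?P (indicator A)) A = emeasure (density ?P (\<lambda>_. emeasure ?P A)) A"
    by simp
  then have "emeasure ?P A = emeasure ?P A * emeasure ?P A"
    using A by (simp add: emeasure_density nn_integral_cmult indicator_inter_arith[symmetric])
  then have "P.prob A = P.prob A * P.prob A"
    by (simp add: P.emeasure_eq_measure ennreal_mult[symmetric])
  then have "P.prob A = 0 \<or> P.prob A = 1" by simp
  then show ?thesis
    using A P.prob_eq_0[OF A] P.prob_eq_1[OF A] by auto
qed

lemma liminf_eq_if_diff_tendsto_0:
  fixes a b :: "nat \<Rightarrow> real"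
  assumes "(\<lambda>n. a n - b n) \<longlonglongrightarrow> 0"
  shows "liminf (\<lambda>n. ereal (a n)) = liminf (\<lambda>n. ereal (b n))"
proof -
  have "liminf (\<lambda>n. ereal (a n - b n) + ereal (b n)) = 0 + liminf (\<lambda>n. ereal (b n))"
    using assms by (intro ereal_liminf_lim_add) (auto simp: zero_ereal_def)
  then show ?thesis by simp
qed

text \<open>A change of one coordinate alters the sequence by a null sequence, hence leaves its
  liminf alone. The liminf is taken in \<open>ereal\<close> because the sequence may be
  unbounded.\<close>

lemma PiM_liminf_zero_one:
  fixes X :: "nat \<Rightarrow> ('i \<Rightarrow> 'a) \<Rightarrow> real" and c :: ereal
  assumes M: "\<And>i. prob_space (M i)" and X: "\<And>n. X n \<in> borel_measurable (PiM UNIV M)"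
    and diff: "\<And>\<xi> i x. \<xi> \<in> space (PiM UNIV M) \<Longrightarrow> x \<in> space (M i) \<Longrightarrow> (\<lambda>n. X n (\<xi>(i := x)) - X n \<xi>) \<longlonglongrightarrow> 0"
  shows "(AE \<xi> in PiM UNIV M. liminf (\<lambda>n. ereal (X n \<xi>)) < c) \<or> (AE \<xi> in PiM UNIV M. c \<le> liminf (\<lambda>n. ereal (X n \<xi>)))"
proof -
  note [measurable] = X
  let ?A = "{\<xi> \<in> space (PiM UNIV M). liminf (\<lambda>n. ereal (X n \<xi>)) < c}"
  have A: "?A \<in> sets (PiM UNIV M)" by measurable
  have "(AE \<xi> in PiM UNIV M. \<xi> \<in> ?A) \<or> (AE \<xi> in PiM UNIV M. \<xi> \<notin> ?A)"
  proof (rule PiM_zero_one_law[OF M A])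
    fix \<xi> i x assume *: "\<xi> \<in> space (PiM UNIV M)" "x \<in> space (M i)"
    have "\<xi>(i := x) \<in> space (PiM UNIV M)"
      using * by (auto simp: space_PiM PiE_iff)
    with liminf_eq_if_diff_tendsto_0[OF diff[OF *]] * show "\<xi>(i := x) \<in> ?A \<longleftrightarrow> \<xi> \<in> ?A"
      by simp
  qed
  then show ?thesis
  proof
    assume "AE \<xi> in PiM UNIV M. \<xi> \<in> ?A" then show ?thesis by (auto elim: AE_mp)
  next
    assume "AE \<xi> in PiM UNIV M. \<xi> \<notin> ?A"
    then have "AE \<xi> in PiM UNIV M. c \<le> liminf (\<lambda>n. ereal (X n \<xi>))"
      using AE_space by eventually_elim auto
    then show ?thesis ..
  qed
qed


section \<open>Covering argument for stationary subadditive processes\<close>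

lemma subadditive_decomposition:
  fixes g :: "nat \<Rightarrow> 'a \<Rightarrow> real" and \<theta> :: "nat \<Rightarrow> 'a \<Rightarrow> 'a"
  assumes \<theta>: "\<And>i j x. \<theta> (i + j) x = \<theta> j (\<theta> i x)"
    and g0: "\<And>x. g 0 x \<le> 0" and sub: "\<And>m n x. g (m + n) x \<le> g m x + g n (\<theta> m x)"
    and a: "\<And>i. 0 \<le> a i"
    and skip: "\<And>i. i < n \<Longrightarrow> g 1 (\<theta> i x) \<le> a i \<or> (\<exists>l\<ge>1. i + l \<le> n \<and> g l (\<theta> i x) \<le> 0)"
  shows "k \<le> n \<Longrightarrow> g k (\<theta> (n - k) x) \<le> (\<Sum>i\<in>{n-k..<n}. a i)"
proof (induction k rule: less_induct)
  case (less k)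
  show ?case
  proof (cases "k = 0")
    case True
    then show ?thesis using g0 by simp
  next
    case False
    define m where "m = n - k"
    have m: "m < n" "n - m = k" "m + k = n" using False less.prems by (auto simp: m_def)
    have step: "g k (\<theta> m x) \<le> g l (\<theta> m x) + (\<Sum>i\<in>{m+l..<n}. a i)" if "1 \<le> l" "l \<le> k" for l
    proof -
      have "g k (\<theta> m x) \<le> g l (\<theta> m x) + g (k - l) (\<theta> (m + l) x)"
        using sub[of l "k - l" "\<theta> m x"] that by (simp add: \<theta>)
      moreover have "n - (k - l) = m + l" using m that by simp
      ultimately show ?thesis
        using less.IH[of "k - l"] less.prems that diff_le_self[of k l] by force
    qed
    from skip[OF m(1)] show ?thesis
    proof
      assume "g 1 (\<theta> m x) \<le> a m"
      moreover have "(\<Sum>i\<in>{m..<n}. a i) = a m + (\<Sum>i\<in>{m+1..<n}. a i)"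
        using m by (simp add: sum.atLeast_Suc_lessThan)
      ultimately show ?thesis using step[of 1] False by (simp add: m_def)
    next
      assume "\<exists>l\<ge>1. m + l \<le> n \<and> g l (\<theta> m x) \<le> 0"
      then obtain l where l: "1 \<le> l" "l \<le> k" "g l (\<theta> m x) \<le> 0" using m by auto
      have "(\<Sum>i\<in>{m+l..<n}. a i) \<le> (\<Sum>i\<in>{m..<n}. a i)"
        using a by (intro sum_mono2) auto
      with step[of l] l show ?thesis by (simp add: m_def)
    qed
  qed
qed

text \<open>Steele's argument for the lower half of Kingman's theorem: cut the orbit into stretches
  along which \<open>g\<close> is nonpositive; the points from which no such stretch of length at most \<open>N\<close>
  starts cost \<open>g 1\<close> each and become negligible as \<open>N \<rightarrow> \<infinity>\<close>.\<close>

lemma subadditive_growth_nonpos: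
  fixes g :: "nat \<Rightarrow> 'a \<Rightarrow> real" and \<theta> :: "nat \<Rightarrow> 'a \<Rightarrow> 'a" and \<gamma> :: real
  assumes "prob_space M"
    and meas: "\<And>i. \<theta> i \<in> measurable M M" and pres: "\<And>i. distr M M (\<theta> i) = M"
    and \<theta>0: "\<And>x. \<theta> 0 x = x" and \<theta>: "\<And>i j x. \<theta> (i + j) x = \<theta> j (\<theta> i x)"
    and int: "\<And>n. integrable M (g n)"
    and g0: "\<And>x. g 0 x \<le> 0" and sub: "\<And>m n x. g (m + n) x \<le> g m x + g n (\<theta> m x)"
    and hit: "AE x in M. \<exists>l\<ge>1. g l x \<le> 0"
    and \<gamma>: "\<And>n. \<gamma> * real n \<le> (\<integral>x. g n x \<partial>M)"
  shows "\<gamma> \<le> 0"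
proof -
  interpret prob_space M by fact
  note [measurable] = meas borel_measurable_integrable[OF int]
  define h where "h x = max 0 (g 1 x)" for x
  define b where "b N x = (if \<exists>l\<in>{1..N}. g l x \<le> 0 then 0 else h x)" for N x
  have [measurable]: "h \<in> borel_measurable M" "b N \<in> borel_measurable M" for N
    unfolding h_def b_def by measurable
  have h: "integrable M h" unfolding h_def using int by auto
  have b_le: "0 \<le> b N x" "b N x \<le> h x" "0 \<le> h x" for N x by (auto simp: b_def h_def)
  have b: "integrable M (b N)" for N
    by (rule Bochner_Integration.integrable_bound[OF h]) (use b_le in auto)
  have int_\<theta>: "integrable M (\<lambda>x. f (\<theta> i x))" "(\<integral>x. f (\<theta> i x) \<partial>M) = (\<integral>x. f x \<partial>M)"
    if "integrable M f" for f :: "'a \<Rightarrow> real" and i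
    using integrable_distr[OF meas[of i], of f] integral_distr[OF meas[of i], of f] that by (auto simp: pres)
  have bound: "\<gamma> * real n \<le> real n * (\<integral>x. b N x \<partial>M) + real N * (\<integral>x. h x \<partial>M)" for n N
  proof -
    \<comment> \<open>The extra summand pays for times so close to \<open>n\<close> that a stretch
      of length up to \<open>N\<close> could overshoot; there are at most \<open>N\<close> of
      them.\<close>
    have "g n x \<le> (\<Sum>i<n. b N (\<theta> i x) + (if n < i + N then h (\<theta> i x) else 0))" for x
    proof -
      let ?a = "\<lambda>i. b N (\<theta> i x) + (if n < i + N then h (\<theta> i x) else 0)"
      have "g 1 (\<theta> i x) \<le> ?a i \<or> (\<exists>l\<ge>1. i + l \<le> n \<and> g l (\<theta> i x) \<le> 0)" for i
      proof (cases "n < i + N \<or> (\<forall>l\<in>{1..N}. g l (\<theta> i x) > 0)")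
        case True
        have "g 1 (\<theta> i x) \<le> h (\<theta> i x)" by (simp add: h_def)
        with True show ?thesis
          using b_le(1)[of N "\<theta> i x"] b_le(3)[of "\<theta> i x"] by (auto simp: b_def not_le)
      qed force
      then have "g n (\<theta> (n - n) x) \<le> (\<Sum>i\<in>{n-n..<n}. ?a i)"
        using b_le by (intro subadditive_decomposition[OF \<theta> g0 sub]) auto
      then show ?thesis by (simp add: \<theta>0 lessThan_atLeast0)
    qed
    moreover have k: "integrable M (\<lambda>x. b N (\<theta> i x) + (if n < i + N then h (\<theta> i x) else 0))"
      "(\<integral>x. b N (\<theta> i x) + (if n < i + N then h (\<theta> i x) else 0) \<partial>M) = (\<integral>x. b N x \<partial>M) + (if n < i + N then (\<integral>x. h x \<partial>M) else 0)" for i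
      using int_\<theta>[OF b, of N i] int_\<theta>[OF h, of i] by (cases "n < i + N"; simp)+
    ultimately have "(\<integral>x. g n x \<partial>M) \<le> (\<integral>x. (\<Sum>i<n. b N (\<theta> i x) + (if n < i + N then h (\<theta> i x) else 0)) \<partial>M)"
      by (intro integral_mono int) auto
    also have "\<dots> = (\<Sum>i<n. (\<integral>x. b N x \<partial>M) + (if n < i + N then (\<integral>x. h x \<partial>M) else 0))"
      using k by (simp only: Bochner_Integration.integral_sum)
    also have "\<dots> = real n * (\<integral>x. b N x \<partial>M) + real (card {i\<in>{..<n}. n < i + N}) * (\<integral>x. h x \<partial>M)"
      by (simp add: sum.distrib sum.If_cases Int_def)
    also have "\<dots> \<le> real n * (\<integral>x. b N x \<partial>M) + real N * (\<integral>x. h x \<partial>M)"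
    proof -
      have "card {i\<in>{..<n}. n < i + N} \<le> card {n-N..<n}" by (intro card_mono) auto
      then show ?thesis using b_le by (intro add_left_mono mult_right_mono) auto
    qed
    finally show ?thesis using \<gamma>[of n] by linarith
  qed
  \<comment> \<open>For fixed \<open>N\<close> the boundary cost in \<open>bound\<close> does not
    grow with \<open>n\<close>, so it disappears on division by a large \<open>n\<close>.\<close>
  have "\<gamma> \<le> (\<integral>x. b N x \<partial>M)" for N
  proof (rule ccontr)
    assume "\<not> ?thesis"
    then obtain n where "real N * (\<integral>x. h x \<partial>M) < real n * (\<gamma> - (\<integral>x. b N x \<partial>M))"
      using reals_Archimedean3[of "\<gamma> - (\<integral>x. b N x \<partial>M)"] by auto
    with bound[of n N] show False by (simp add: algebra_simps)
  qed
  \<comment> \<open>By \<open>hit\<close>, \<open>b N x\<close> vanishes for all large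
    \<open>N\<close>, at almost every \<open>x\<close>.\<close>
  moreover have "(\<lambda>N. \<integral>x. b N x \<partial>M) \<longlonglongrightarrow> (\<integral>x. 0 \<partial>M)"
  proof (rule integral_dominated_convergence[OF _ _ h])
    show "AE x in M. (\<lambda>N. b N x) \<longlonglongrightarrow> 0"
      using hit
    proof eventually_elim
      fix x assume "\<exists>l\<ge>1. g l x \<le> 0"
      then obtain l where l: "l \<ge> 1" "g l x \<le> 0" by auto
      then have "\<forall>\<^sub>F N in sequentially. b N x = 0"
        unfolding eventually_sequentially b_def by (intro exI[of _ l]) force
      then show "(\<lambda>N. b N x) \<longlonglongrightarrow> 0" by (rule tendsto_eventually)
    qed
  qed (use b_le in auto)
  ultimately show ?thesis
    by (intro LIMSEQ_le_const) auto
qed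


text \<open>Insensitivity to single coordinates takes the place of ergodicity. For \<open>d\<close>
  strictly between \<open>c\<close> and \<open>\<gamma>\<close>, the zero-one law leaves two cases;
  if the liminf of \<open>g n / n\<close> were almost surely below \<open>d\<close>, then
  \<open>g n - d * n\<close> would almost surely become nonpositive at some time and the growth
  lemma would give \<open>\<gamma> \<le> d\<close>.\<close>

lemma PiM_subadditive_liminf:
  fixes g :: "nat \<Rightarrow> ('i \<Rightarrow> 'b) \<Rightarrow> real" and \<theta> :: "nat \<Rightarrow> ('i \<Rightarrow> 'b) \<Rightarrow> ('i \<Rightarrow> 'b)" and c \<gamma> :: real
    and M :: "'i \<Rightarrow> 'b measure"
  defines "P \<equiv> PiM UNIV M"
  assumes M: "\<And>i. prob_space (M i)"
    and meas: "\<And>i. \<theta> i \<in> measurable P P" and pres: "\<And>i. distr P P (\<theta> i) = P"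
    and \<theta>0: "\<And>x. \<theta> 0 x = x" and \<theta>: "\<And>i j x. \<theta> (i + j) x = \<theta> j (\<theta> i x)"
    and int: "\<And>n. integrable P (g n)"
    and g0: "\<And>x. g 0 x = 0" and sub: "\<And>m n x. g (m + n) x \<le> g m x + g n (\<theta> m x)"
    and diff: "\<And>\<xi> i x. x \<in> space (M i) \<Longrightarrow> (\<lambda>n. (g n (\<xi>(i := x)) - g n \<xi>) / real n) \<longlonglongrightarrow> 0"
    and \<gamma>: "\<And>n. \<gamma> * real n \<le> (\<integral>x. g n x \<partial>P)" and "c < \<gamma>"
  shows "AE \<xi> in P. \<forall>\<^sub>F n in sequentially. c * real n \<le> g n \<xi>"
proof -
  interpret P: prob_space P unfolding P_def by (intro prob_space_PiM M)
  define d where "d = (c + \<gamma>) / 2"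
  have d: "c < d" "d < \<gamma>" using \<open>c < \<gamma>\<close> by (auto simp: d_def)
  have "(AE \<xi> in P. liminf (\<lambda>n. ereal (g n \<xi> / real n)) < d) \<or> (AE \<xi> in P. d \<le> liminf (\<lambda>n. ereal (g n \<xi> / real n)))"
    unfolding P_def using diff int
    by (intro PiM_liminf_zero_one M) (auto simp: P_def diff_divide_distrib[symmetric])
  then show ?thesis
  proof
    assume "AE \<xi> in P. liminf (\<lambda>n. ereal (g n \<xi> / real n)) < d"
    then have hit: "AE \<xi> in P. \<exists>l\<ge>1. g l \<xi> - d * real l \<le> 0"
    proof eventually_elim
      fix \<xi> assume "liminf (\<lambda>n. ereal (g n \<xi> / real n)) < d"
      then have "\<exists>\<^sub>F n in sequentially. ereal (g n \<xi> / real n) < d"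
        using Liminf_bounded[of "ereal d" "\<lambda>n. ereal (g n \<xi> / real n)" sequentially]
        by (auto simp: frequently_def not_less)
      then have "\<exists>\<^sub>F n in sequentially. ereal (g n \<xi> / real n) < d \<and> n \<ge> 1"
        using eventually_ge_at_top[of 1] by (rule frequently_eventually_frequently)
      then obtain l where "g l \<xi> / real l < d" "l \<ge> 1"
        by (auto dest!: frequently_ex)
      then show "\<exists>l\<ge>1. g l \<xi> - d * real l \<le> 0"
        by (intro exI[of _ l]) (simp add: divide_less_eq)
    qed
    have "\<gamma> - d \<le> 0"
    proof (rule subadditive_growth_nonpos[OF P.prob_space_axioms meas pres \<theta>0 \<theta> _ _ _ hit])
      show "g (m + n) x - d * real (m + n) \<le> g m x - d * real m + (g n (\<theta> m x) - d * real n)" for m n x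
        using sub[of m n x] by (simp add: algebra_simps)
      show "(\<gamma> - d) * real n \<le> (\<integral>x. g n x - d * real n \<partial>P)" for n
        using \<gamma>[of n] int by (simp add: algebra_simps P.prob_space)
    qed (use int g0 in auto)
    with d show ?thesis by simp
  next
    assume "AE \<xi> in P. d \<le> liminf (\<lambda>n. ereal (g n \<xi> / real n))"
    then show ?thesis
    proof eventually_elim
      fix \<xi> assume "d \<le> liminf (\<lambda>n. ereal (g n \<xi> / real n))"
      then have "ereal c < liminf (\<lambda>n. ereal (g n \<xi> / real n))"
        using d by (auto intro: less_le_trans[of _ "ereal d"])
      from less_LiminfD[OF this] eventually_gt_at_top[of 0]
      show "\<forall>\<^sub>F n in sequentially. c * real n \<le> g n \<xi>"
        by eventually_elim (simp add: less_divide_eq)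
    qed
  qed
qed

section \<open>Passage times on the square lattice\<close>

fun path_edges :: "vertex list \<Rightarrow> edge list" where
  "path_edges (a # b # p) = nn_edge a b # path_edges (b # p)"
| "path_edges _ = []"

lemma path_weight_eq_sum_list: "path_weight \<tau> p = sum_list (map \<tau> (path_edges p))"
proof (induction p rule: path_edges.induct)
  case (1 a b p)
  have "path_weight \<tau> (a # b # p) = (\<Sum>i<Suc (length p). \<tau> (nn_edge ((a # b # p) ! i) ((a # b # p) ! Suc i)))"
    by (simp add: path_weight_def)
  also have "\<dots> = \<tau> (nn_edge a b) + path_weight \<tau> (b # p)"
    by (subst sum.lessThan_Suc_shift) (simp add: path_weight_def)
  finally show ?case using 1 by simp
qed (auto simp: path_weight_def)

lemma is_path_iff_successively:
  "is_path u v p \<longleftrightarrow> p \<noteq> [] \<and> hd p = u \<and> last p = v \<and> successively nn_adj p"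
  by (simp add: is_path_def successively_conv_nth)

lemma is_path_single: "is_path u u [u]"
  by (simp add: is_path_iff_successively)

lemma is_path_step: "nn_adj u v \<Longrightarrow> is_path u v [u, v]"
  by (simp add: is_path_iff_successively)

lemma path_edges_append:
  "p \<noteq> [] \<Longrightarrow> path_edges (p @ q) = path_edges p @ path_edges (last p # q)"
proof (induction p rule: path_edges.induct)
  case ("2_2" a)
  then show ?case by (cases q) auto
qed auto

lemma
  assumes p: "is_path u v p" and q: "is_path v w q"
  shows is_path_append: "is_path u w (p @ tl q)"
    and path_weight_append: "path_weight \<tau> (p @ tl q) = path_weight \<tau> p + path_weight \<tau> q"
proof -
  obtain q' where q': "q = v # q'"
    using q by (cases q) (auto simp: is_path_iff_successively)
  show "is_path u w (p @ tl q)"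
    using p q unfolding q'
    by (cases q') (auto simp: is_path_iff_successively successively_append_iff)
  show "path_weight \<tau> (p @ tl q) = path_weight \<tau> p + path_weight \<tau> q"
    using p unfolding q' by (simp add: path_weight_eq_sum_list path_edges_append is_path_iff_successively)
qed

text \<open>An induction principle for relations between lattice points, used for the existence of
  paths and of path families with integrable minimum. Symmetry of \<open>R\<close> is not assumed,
  so each of the four oriented unit steps appears.\<close>

lemma lattice_connected:
  assumes refl: "\<And>u. R u u" and trans: "\<And>u v z. R u v \<Longrightarrow> R v z \<Longrightarrow> R u z"
    and step: "\<And>x y. R (x, y) (x + 1, y)" "\<And>x y. R (x + 1, y) (x, y)"
      "\<And>x y. R (x, y) (x, y + 1)" "\<And>x y. R (x, y + 1) (x, y)"
  shows "R (u :: vertex) v"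
proof -
  have h: "R (x, y) (x + int n, y) \<and> R (x + int n, y) (x, y)" for x y n
  proof (induction n)
    case (Suc n)
    have "x + int n + 1 = x + int (Suc n)" by simp
    with step(1)[of "x + int n" y] step(2)[of "x + int n" y] Suc show ?case
      by (metis trans)
  qed (simp add: refl)
  have v: "R (x, y) (x, y + int n) \<and> R (x, y + int n) (x, y)" for x y n
  proof (induction n)
    case (Suc n)
    have "y + int n + 1 = y + int (Suc n)" by simp
    with step(3)[of x "y + int n"] step(4)[of x "y + int n"] Suc show ?case
      by (metis trans)
  qed (simp add: refl)
  obtain x y x' y' where uv: "u = (x, y)" "v = (x', y')" by fastforce
  have "R (x, y) (x', y)"
    using h[of x y "nat (x' - x)"] h[of x' y "nat (x - x')"] by (cases "x \<le> x'") auto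
  moreover have "R (x', y) (x', y')"
    using v[of x' y "nat (y' - y)"] v[of x' y' "nat (y - y')"] by (cases "y \<le> y'") auto
  ultimately show ?thesis unfolding uv by (rule trans)
qed

lemma ex_path: "\<exists>p. is_path u v p"
proof (rule lattice_connected[of "\<lambda>u v. \<exists>p. is_path u v p"])
  show "\<exists>p. is_path u u p" for u using is_path_single by blast
  show "\<exists>p. is_path u w p" if "\<exists>p. is_path u v p" "\<exists>p. is_path v w p" for u v w
    using that is_path_append by blast
qed (rule exI, rule is_path_step, simp add: nn_adj_def)+

section \<open>Translations of paths and weights\<close>

definition shift_edge :: "vertex \<Rightarrow> edge \<Rightarrow> edge" where
  "shift_edge d e = (fst e + d, snd e)"

lemma shift_edge_simps [simp]:
  "shift_edge 0 e = e" "shift_edge d (shift_edge d' e) = shift_edge (d + d') e"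
  "shift_edge d e = shift_edge d e' \<longleftrightarrow> e = e'" "snd (shift_edge d e) = snd e"
  by (auto simp: shift_edge_def prod_eq_iff)

lemma nn_edge_shift: "nn_edge (a + d) (b + d) = shift_edge d (nn_edge a b)"
  by (auto simp: nn_edge_def shift_edge_def prod_eq_iff min_add_distrib_left)

lemma path_edges_shift: "path_edges (map (\<lambda>a. a + d) p) = map (shift_edge d) (path_edges p)"
  by (induction p rule: path_edges.induct) (auto simp: nn_edge_shift)

lemma path_weight_shift: "path_weight \<tau> (map (\<lambda>a. a + d) p) = path_weight (\<lambda>e. \<tau> (shift_edge d e)) p"
  by (simp add: path_weight_eq_sum_list path_edges_shift o_def)

lemma is_path_shift: "is_path u v p \<Longrightarrow> is_path (u + d) (v + d) (map (\<lambda>a. a + d) p)"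
  by (auto simp: is_path_iff_successively successively_map nn_adj_def hd_map last_map)

lemma passage_time_shift:
  "passage_time \<tau> (u + d) (v + d) = passage_time (\<lambda>e. \<tau> (shift_edge d e)) u v"
proof -
  have "{p. is_path (u + d) (v + d) p} = map (\<lambda>a. a + d) ` {p. is_path u v p}"
  proof (intro equalityI subsetI)
    fix p assume "p \<in> {p. is_path (u + d) (v + d) p}"
    then have "is_path u v (map (\<lambda>a. a + (- d)) p)"
      using is_path_shift[of "u + d" "v + d" p "- d"] by simp
    moreover have "p = map (\<lambda>a. a + d) (map (\<lambda>a. a + (- d)) p)"
      by (simp add: o_def)
    ultimately show "p \<in> map (\<lambda>a. a + d) ` {p. is_path u v p}" by blast
  qed (auto intro: is_path_shift)
  then show ?thesis
    by (simp add: passage_time_def image_image path_weight_shift)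
qed

lemma passage_time_cong:
  assumes "\<And>e. \<tau> e = \<tau>' e" shows "passage_time \<tau> u v = passage_time \<tau>' u v"
proof -
  have "\<tau> = \<tau>'" by (rule ext) (rule assms)
  then show ?thesis by simp
qed

section \<open>Elementary bounds for nonnegative weights\<close>

context
  fixes \<tau> :: "edge \<Rightarrow> real"
  assumes \<tau>_nonneg: "\<forall>e. 0 \<le> \<tau> e"
begin

lemma path_weight_nonneg: "0 \<le> path_weight \<tau> p"
  unfolding path_weight_def by (intro sum_nonneg \<tau>_nonneg[rule_format])

lemma bdd_below_path_weight: "bdd_below (path_weight \<tau> ` A)"
  using path_weight_nonneg by (auto intro: bdd_belowI[of _ 0])

lemma passage_time_le: "is_path u v p \<Longrightarrow> passage_time \<tau> u v \<le> path_weight \<tau> p"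
  unfolding passage_time_def by (intro cInf_lower bdd_below_path_weight) auto

lemma passage_time_greatest: "(\<And>p. is_path u v p \<Longrightarrow> c \<le> path_weight \<tau> p) \<Longrightarrow> c \<le> passage_time \<tau> u v"
  unfolding passage_time_def using ex_path by (intro cInf_greatest) auto

lemma passage_time_nonneg: "0 \<le> passage_time \<tau> u v"
  by (intro passage_time_greatest path_weight_nonneg)

lemma passage_time_self: "passage_time \<tau> u u = 0"
  using passage_time_le[OF is_path_single, of u] passage_time_nonneg[of u u]
  by (simp add: path_weight_def)

lemma passage_time_triangle: "passage_time \<tau> u w \<le> passage_time \<tau> u v + passage_time \<tau> v w"
proof -
  have "passage_time \<tau> u w - path_weight \<tau> q \<le> passage_time \<tau> u v" if q: "is_path v w q" for q
  proof (rule passage_time_greatest)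
    fix p assume p: "is_path u v p"
    show "passage_time \<tau> u w - path_weight \<tau> q \<le> path_weight \<tau> p"
      using passage_time_le[OF is_path_append[OF p q]] path_weight_append[OF p q, of \<tau>] by simp
  qed
  then have "passage_time \<tau> u w - passage_time \<tau> u v \<le> passage_time \<tau> v w"
    by (intro passage_time_greatest) (simp add: algebra_simps)
  then show ?thesis by simp
qed

end

section \<open>Changing the weight of one edge\<close>

definition edge_ends :: "edge \<Rightarrow> vertex set" where
  "edge_ends e = {fst e, fst e + (if snd e then (0, 1) else (1, 0))}"

lemma nn_edge_ends:
  assumes "nn_adj a b" shows "{a, b} = edge_ends (nn_edge a b)"
  using assms by (auto simp: nn_adj_def nn_edge_def edge_ends_def prod_eq_iff min_def)

text \<open>Traversing \<open>e\<close> means arriving at one of its ends, and this arrival comes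
  after the starting vertex \<open>a\<close>. Thus a path may start at an end of \<open>e\<close>
  and still avoid \<open>e\<close> if it never meets an end of \<open>e\<close> again.\<close>

lemma path_edges_ends:
  assumes "e \<in> set (path_edges (a # p))" "successively nn_adj (a # p)"
  shows "\<exists>b\<in>set p. b \<in> edge_ends e"
  using assms
proof (induction p arbitrary: a)
  case (Cons b p)
  from Cons.prems consider "e = nn_edge a b" | "e \<in> set (path_edges (b # p))" by auto
  then show ?case
  proof cases
    case 1
    then show ?thesis using nn_edge_ends[of a b] Cons.prems by auto
  next
    case 2
    then show ?thesis using Cons.IH[of b] Cons.prems by auto
  qed
qed auto

text \<open>Cutting a path at its last visit to an endpoint of \<open>e\<close> leaves a piece that avoids \<open>e\<close>.\<close>

lemma passage_time_change_edge:
  assumes nonneg: "\<forall>e. 0 \<le> \<tau> e" "\<forall>e. 0 \<le> \<tau>' e" and eq: "\<And>e'. e' \<noteq> e \<Longrightarrow> \<tau>' e' = \<tau> e'"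
  shows "passage_time \<tau>' u v \<le> passage_time \<tau> u v + (\<Sum>z\<in>edge_ends e. passage_time \<tau>' u z)"
proof -
  let ?K = "\<Sum>z\<in>edge_ends e. passage_time \<tau>' u z"
  have fin: "finite (edge_ends e)" by (simp add: edge_ends_def)
  have K: "0 \<le> ?K"
    by (intro sum_nonneg passage_time_nonneg nonneg)
  have same: "path_weight \<tau>' p = path_weight \<tau> p" if "e \<notin> set (path_edges p)" for p
    unfolding path_weight_eq_sum_list
    by (rule arg_cong[where f = sum_list], rule map_cong[OF refl], rule eq) (use that in auto)
  have "passage_time \<tau>' u v - ?K \<le> path_weight \<tau> p" if p: "is_path u v p" for p
  proof (cases "\<exists>z\<in>set p. z \<in> edge_ends e")
    case False
    have "e \<notin> set (path_edges p)"
      using p False path_edges_ends[of e "hd p" "tl p"]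
      by (cases p) (auto simp: is_path_iff_successively)
    from passage_time_le[OF nonneg(2) p] same[OF this] K show ?thesis by simp
  next
    case True
    then obtain xs z ys where s: "p = xs @ z # ys" "z \<in> edge_ends e" "\<forall>y\<in>set ys. y \<notin> edge_ends e"
      using split_list_last_prop[of p "\<lambda>z. z \<in> edge_ends e"] by blast
    have path: "is_path z v (z # ys)" and "successively nn_adj (z # ys)"
      using p unfolding s is_path_iff_successively by (auto simp: successively_append_iff)
    then have e: "e \<notin> set (path_edges (z # ys))"
      using s(3) path_edges_ends by blast
    have "path_edges p = path_edges (xs @ [z]) @ path_edges (z # ys)"
      using path_edges_append[of "xs @ [z]" ys] by (simp add: s)
    then have "path_weight \<tau> p = path_weight \<tau> (xs @ [z]) + path_weight \<tau> (z # ys)"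
      by (simp add: path_weight_eq_sum_list)
    with path_weight_nonneg[OF nonneg(1)] have "path_weight \<tau> (z # ys) \<le> path_weight \<tau> p" by simp
    \<comment> \<open>The piece before \<open>z\<close> is exchanged for the new passage time from
      \<open>u\<close> to \<open>z\<close>, which does not involve the target
      \<open>v\<close>.\<close>
    moreover have "passage_time \<tau>' u v \<le> passage_time \<tau>' u z + path_weight \<tau>' (z # ys)"
      using passage_time_triangle[OF nonneg(2), of u v z] passage_time_le[OF nonneg(2) path] by simp
    moreover have "passage_time \<tau>' u z \<le> ?K"
      using fin s(2) passage_time_nonneg[OF nonneg(2)] by (intro member_le_sum) auto
    ultimately show ?thesis using same[OF e] by simp
  qed
  then have "passage_time \<tau>' u v - ?K \<le> passage_time \<tau> u v"
    by (intro passage_time_greatest nonneg)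
  then show ?thesis by simp
qed

section \<open>Minimal weights over finite families of paths\<close>

definition min_weight :: "(edge \<Rightarrow> real) \<Rightarrow> vertex list set \<Rightarrow> real" where
  "min_weight \<tau> J = Min (path_weight \<tau> ` J)"

lemma min_weight_le: "finite J \<Longrightarrow> p \<in> J \<Longrightarrow> min_weight \<tau> J \<le> path_weight \<tau> p"
  by (simp add: min_weight_def)

lemma min_weight_attained: "finite J \<Longrightarrow> J \<noteq> {} \<Longrightarrow> \<exists>p\<in>J. min_weight \<tau> J = path_weight \<tau> p"
  using Min_in[of "path_weight \<tau> ` J"] unfolding min_weight_def by blast

lemma passage_time_le_min_weight:
  assumes "\<forall>e. 0 \<le> \<tau> e" "finite J" "J \<noteq> {}" "J \<subseteq> {p. is_path u v p}"
  shows "passage_time \<tau> u v \<le> min_weight \<tau> J"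
proof -
  obtain p where "p \<in> J" "min_weight \<tau> J = path_weight \<tau> p"
    using min_weight_attained[OF assms(2,3)] by blast
  then show ?thesis using assms(4) passage_time_le[OF assms(1), of u v p] by auto
qed

lemma min_weight_nonneg:
  assumes "\<forall>e. 0 \<le> \<tau> e" "finite J" "J \<noteq> {}" shows "0 \<le> min_weight \<tau> J"
  using min_weight_attained[OF assms(2,3)] path_weight_nonneg[OF assms(1)] by metis

lemma min_weight_shift:
  "min_weight \<tau> (map (\<lambda>a. a + d) ` J) = min_weight (\<lambda>e. \<tau> (shift_edge d e)) J"
  by (simp add: min_weight_def image_image path_weight_shift)

lemma min_weight_cong:
  assumes "\<And>p e. p \<in> J \<Longrightarrow> e \<in> set (path_edges p) \<Longrightarrow> \<tau> e = \<tau>' e"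
  shows "min_weight \<tau> J = min_weight \<tau>' J"
  unfolding min_weight_def path_weight_eq_sum_list using assms
  by (intro arg_cong[where f = Min] image_cong refl arg_cong[where f = sum_list] map_cong) auto

text \<open>Every single path eventually belongs to \<open>J k\<close>, so the minima drop below
  each number above the infimum, while no minimum is less than the infimum.\<close>

lemma min_weight_tendsto_passage_time:
  assumes \<tau>: "\<forall>e. 0 \<le> \<tau> e"
    and J: "\<And>k. finite (J k)" "\<And>k. J k \<noteq> {}" "incseq J" "(\<Union>k. J k) = {p. is_path u v p}"
  shows "(\<lambda>k. min_weight \<tau> (J k)) \<longlonglongrightarrow> passage_time \<tau> u v"
proof (rule order_tendstoI)
  fix a assume "a < passage_time \<tau> u v"
  moreover have "J k \<subseteq> {p. is_path u v p}" for k using J(4) by blast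
  ultimately have "a < min_weight \<tau> (J k)" for k
    using passage_time_le_min_weight[OF \<tau> J(1,2), of k u v] by (meson less_le_trans)
  then show "\<forall>\<^sub>F k in sequentially. a < min_weight \<tau> (J k)" by simp
next
  fix a assume "passage_time \<tau> u v < a"
  moreover have "path_weight \<tau> ` {p. is_path u v p} \<noteq> {}" using ex_path[of u v] by simp
  ultimately have "\<exists>y\<in>path_weight \<tau> ` {p. is_path u v p}. y < a"
    using cInf_less_iff[OF _ bdd_below_path_weight[OF \<tau>]] unfolding passage_time_def by metis
  then obtain p where p: "is_path u v p" "path_weight \<tau> p < a" by auto
  then obtain k0 where "p \<in> J k0" using J(4) by auto
  with p have "min_weight \<tau> (J k) < a" if "k \<ge> k0" for k
    using min_weight_le[OF J(1), of p k \<tau>] incseqD[OF J(3) that] by (auto simp: subset_eq intro: le_less_trans)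
  then show "\<forall>\<^sub>F k in sequentially. min_weight \<tau> (J k) < a"
    unfolding eventually_sequentially by blast
qed

text \<open>An infimum that is not bounded below has a fixed junk value, so no lower bound is needed.\<close>

lemma borel_measurable_real_Inf:
  fixes f :: "'i \<Rightarrow> 'a \<Rightarrow> real"
  assumes I: "countable I" "I \<noteq> {}" and [measurable]: "\<And>i. i \<in> I \<Longrightarrow> f i \<in> borel_measurable M"
  shows "(\<lambda>x. Inf ((\<lambda>i. f i x) ` I)) \<in> borel_measurable M"
proof -
  \<comment> \<open>Natural numbers as bounds turn boundedness below into a countable union of
    measurable conditions.\<close>
  define B where "B x \<longleftrightarrow> (\<exists>m::nat. \<forall>i\<in>I. - real m \<le> f i x)" for x
  \<comment> \<open>On a set without lower bound, the defining \<open>LEAST\<close> ranges over the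
    empty predicate, which is the same for all such sets.\<close>
  define K :: real where "K = - (LEAST z. False)"
  have bdd: "bdd_below ((\<lambda>i. f i x) ` I) \<longleftrightarrow> B x" for x
  proof
    assume "bdd_below ((\<lambda>i. f i x) ` I)"
    then obtain b where b: "\<And>i. i \<in> I \<Longrightarrow> b \<le> f i x" by (auto simp: bdd_below_def)
    obtain m :: nat where "- b \<le> real m" using real_arch_simple by blast
    then show "B x" unfolding B_def using b by (intro exI[of _ m]) force
  qed (auto simp: B_def intro: bdd_belowI)
  have junk: "Inf ((\<lambda>i. f i x) ` I) = K" if "\<not> B x" for x
  proof -
    have no_bound: "(\<forall>y\<in>uminus ` (\<lambda>i. f i x) ` I. y \<le> z) = False" for z
    proof (rule iffI[OF _ FalseE])
      assume "\<forall>y\<in>uminus ` (\<lambda>i. f i x) ` I. y \<le> z"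
      then have "bdd_below ((\<lambda>i. f i x) ` I)" by (intro bdd_belowI[of _ "- z"]) force
      with that bdd show False by blast
    qed
    show ?thesis
      unfolding Inf_real_def Sup_real_def K_def no_bound ..
  qed
  have m: "{x \<in> space M. B x} \<in> sets M"
    unfolding B_def using I by (intro sets.sets_Collect_countable_Ex sets.sets_Collect_countable_All') auto
  show ?thesis
  proof (rule borel_measurableI_less)
    fix a
    have "Inf ((\<lambda>i. f i x) ` I) < a \<longleftrightarrow> (if B x then \<exists>i\<in>I. f i x < a else K < a)" for x
    proof (cases "B x")
      case True
      then have "bdd_below ((\<lambda>i. f i x) ` I)" by (simp add: bdd)
      then show ?thesis using True cInf_less_iff[of "(\<lambda>i. f i x) ` I" a] I(2) by simp
    qed (simp add: junk)
    then have "{x \<in> space M. Inf ((\<lambda>i. f i x) ` I) < a}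
        = {x \<in> space M. B x} \<inter> (\<Union>i\<in>I. {x \<in> space M. f i x < a}) \<union> ({x \<in> space M. \<not> B x} \<inter> {x \<in> space M. K < a})"
      by (auto split: if_splits)
    also have "\<dots> \<in> sets M"
      using m I(1) by (intro sets.Un sets.Int sets.countable_UN' sets.sets_Collect_neg) auto
    finally show "{x \<in> space M. Inf ((\<lambda>i. f i x) ` I) < a} \<in> sets M" .
  qed
qed

section \<open>Measurability of passage times and minimal weights\<close>

lemma borel_measurable_passage_time:
  fixes \<tau> :: "'a \<Rightarrow> edge \<Rightarrow> real"
  assumes [measurable]: "\<And>e. (\<lambda>x. \<tau> x e) \<in> borel_measurable M"
  shows "(\<lambda>x. passage_time (\<tau> x) u v) \<in> borel_measurable M"
  unfolding passage_time_def using ex_path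
  by (intro borel_measurable_real_Inf countableI_type) (auto simp: path_weight_def)

lemma borel_measurable_min_weight:
  fixes \<tau> :: "'a \<Rightarrow> edge \<Rightarrow> real"
  assumes [measurable]: "\<And>e. (\<lambda>x. \<tau> x e) \<in> borel_measurable M" and J: "finite J"
  shows "(\<lambda>x. min_weight (\<tau> x) J) \<in> borel_measurable M"
  unfolding min_weight_def using J
proof (induction J)
  case (insert p J)
  then show ?case by (cases "J = {}") (auto simp: path_weight_def Min_insert)
qed simp

section \<open>First-passage percolation with column-dependent weights\<close>

lemma prob_space_unit_uniform: "prob_space (uniform_measure lborel {0..1::real})"
  by (rule prob_space_uniform_measure) auto

lemma prob_space_edge_measure: "prob_space edge_measure"
  unfolding edge_measure_def by (intro prob_space_PiM prob_space_unit_uniform)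

lemma space_edge_measure [simp]: "space edge_measure = UNIV"
  by (simp add: edge_measure_def space_PiM)

lemma measurable_edge_coordinate [measurable]: "(\<lambda>\<xi>. \<xi> e) \<in> borel_measurable edge_measure"
proof -
  have "(\<lambda>\<xi>. \<xi> e) \<in> measurable edge_measure (uniform_measure lborel {0..1})"
    unfolding edge_measure_def by (rule measurable_component_singleton) simp
  also have "measurable edge_measure (uniform_measure lborel {0..1::real}) = borel_measurable edge_measure"
    by (rule measurable_cong_sets) auto
  finally show ?thesis .
qed

definition shift_env :: "vertex \<Rightarrow> (edge \<Rightarrow> real) \<Rightarrow> edge \<Rightarrow> real" where
  "shift_env d \<xi> = (\<lambda>e. \<xi> (shift_edge d e))"

lemma shift_env_distr: "distr edge_measure edge_measure (shift_env d) = edge_measure"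
  and measurable_shift_env [measurable]: "shift_env d \<in> measurable edge_measure edge_measure"
proof -
  show "distr edge_measure edge_measure (shift_env d) = edge_measure"
    using distr_PiM_reindex[of UNIV "\<lambda>_. uniform_measure lborel {0..1::real}" "shift_edge d" UNIV]
      prob_space_unit_uniform
    by (simp add: edge_measure_def shift_env_def[abs_def] inj_on_def restrict_def)
  show "shift_env d \<in> measurable edge_measure edge_measure"
    unfolding shift_env_def[abs_def] edge_measure_def
    by (rule measurable_PiM_single') (auto simp: space_PiM)
qed

lemma shift_env_0 [simp]: "shift_env 0 \<xi> = \<xi>" "shift_env (0, 0) \<xi> = \<xi>"
  by (simp_all add: shift_env_def zero_prod_def[symmetric])

lemma shift_env_shift_env: "shift_env d (shift_env d' \<xi>) = shift_env (d' + d) \<xi>"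
  by (simp add: shift_env_def)

lemma
  fixes f :: "(edge \<Rightarrow> real) \<Rightarrow> real"
  assumes f: "integrable edge_measure f"
  shows integrable_shift_env: "integrable edge_measure (\<lambda>\<xi>. f (shift_env d \<xi>))"
    and integral_shift_env: "(\<integral>\<xi>. f (shift_env d \<xi>) \<partial>edge_measure) = (\<integral>\<xi>. f \<xi> \<partial>edge_measure)"
  using integrable_distr[OF measurable_shift_env[of d], of f] integral_distr[OF measurable_shift_env[of d], of f] f
  by (auto simp: shift_env_distr)

text \<open>The map applied to the uniform variable may depend on the column and the orientation,
  but not on the row; this makes vertical translations preserve the law of the weights.\<close>

definition column_weights :: "(int \<Rightarrow> bool \<Rightarrow> real \<Rightarrow> real) \<Rightarrow> (edge \<Rightarrow> real) \<Rightarrow> edge \<Rightarrow> real" where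
  "column_weights w \<xi> e = w (fst (fst e)) (snd e) (\<xi> e)"

lemma column_weights_shift:
  "column_weights w \<xi> (shift_edge d e) = column_weights (\<lambda>x. w (x + fst d)) (shift_env d \<xi>) e"
  by (simp add: column_weights_def shift_env_def shift_edge_def)

text \<open>\<open>Q\<close> is an envelope common to all columns. Integrability is assumed only for
  the minimum over four distinct edges, which fits four edge-disjoint paths; a single weight may
  have infinite mean.\<close>

locale column_fpp =
  fixes w :: "int \<Rightarrow> bool \<Rightarrow> real \<Rightarrow> real" and Q :: "real \<Rightarrow> real"
  assumes w_measurable [measurable]: "\<And>x b. w x b \<in> borel_measurable borel"
    and Q_measurable [measurable]: "Q \<in> borel_measurable borel"
    and w_nonneg: "\<And>x b u. 0 \<le> w x b u" and w_le_Q: "\<And>x b u. w x b u \<le> Q u"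
    and Q_integrable: "\<And>e1 e2 e3 e4. distinct [e1, e2, e3, e4] \<Longrightarrow>
      integrable edge_measure (\<lambda>\<xi>. min (min (Q (\<xi> e1)) (Q (\<xi> e2))) (min (Q (\<xi> e3)) (Q (\<xi> e4))))"
begin

abbreviation "\<tau> \<equiv> column_weights w"
abbreviation "T \<xi> \<equiv> passage_time (\<tau> \<xi>)"

lemma \<tau>_nonneg: "\<forall>e. 0 \<le> \<tau> \<xi> e"
  by (simp add: column_weights_def w_nonneg)

lemma Q_nonneg: "0 \<le> Q u"
  using w_nonneg w_le_Q by (rule order_trans)

lemma \<tau>_measurable [measurable]: "(\<lambda>\<xi>. \<tau> \<xi> e) \<in> borel_measurable edge_measure"
  unfolding column_weights_def by measurable

lemma T_measurable [measurable]: "(\<lambda>\<xi>. T \<xi> u v) \<in> borel_measurable edge_measure"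
  by (intro borel_measurable_passage_time \<tau>_measurable)

lemma min_weight_measurable: "finite J \<Longrightarrow> (\<lambda>\<xi>. min_weight (\<tau> \<xi>) J) \<in> borel_measurable edge_measure"
  by (intro borel_measurable_min_weight \<tau>_measurable)

lemma T_shift: "T \<xi> (u + (0, k)) (v + (0, k)) = T (shift_env (0, k) \<xi>) u v"
  by (simp add: passage_time_shift column_weights_shift)

text \<open>With \<open>J\<close> finite, only finitely many vertical shifts of the minimal weight see a given edge,
  so the zero-one law applies to their averages.\<close>

definition good_paths :: "vertex \<Rightarrow> vertex \<Rightarrow> vertex list set \<Rightarrow> bool" where
  "good_paths u v J \<longleftrightarrow> finite J \<and> J \<noteq> {} \<and> J \<subseteq> {p. is_path u v p} \<and>
     integrable edge_measure (\<lambda>\<xi>. min_weight (\<tau> \<xi>) J)"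

lemma good_pathsI:
  assumes "finite J" "J \<noteq> {}" "J \<subseteq> {p. is_path u v p}"
    and "integrable edge_measure f" "\<And>\<xi>. min_weight (\<tau> \<xi>) J \<le> f \<xi>"
  shows "good_paths u v J"
proof -
  have "0 \<le> min_weight (\<tau> \<xi>) J" for \<xi>
    using assms by (intro min_weight_nonneg \<tau>_nonneg) auto
  moreover have "min_weight (\<tau> \<xi>) J \<le> \<bar>f \<xi>\<bar>" for \<xi>
    using assms(5)[of \<xi>] by linarith
  ultimately have "integrable edge_measure (\<lambda>\<xi>. min_weight (\<tau> \<xi>) J)"
    by (intro Bochner_Integration.integrable_bound[OF assms(4) min_weight_measurable]) (use assms in auto)
  with assms show ?thesis by (simp add: good_paths_def)
qed

lemma good_paths_superset:
  assumes "good_paths u v J" "finite J'" "J \<subseteq> J'" "J' \<subseteq> {p. is_path u v p}"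
  shows "good_paths u v J'"
proof (rule good_pathsI)
  show "integrable edge_measure (\<lambda>\<xi>. min_weight (\<tau> \<xi>) J)" using assms by (simp add: good_paths_def)
  show "min_weight (\<tau> \<xi>) J' \<le> min_weight (\<tau> \<xi>) J" for \<xi>
    unfolding min_weight_def using assms by (intro Min_antimono) (auto simp: good_paths_def)
qed (use assms in \<open>auto simp: good_paths_def\<close>)

text \<open>The edge with the largest envelope is retained rather than just the maximum, since
  disjoint paths then yield distinct edges.\<close>

lemma path_weight_le_max:
  assumes "path_edges p \<noteq> []"
  shows "\<exists>e\<in>set (path_edges p). path_weight (\<tau> \<xi>) p \<le> length (path_edges p) * Q (\<xi> e)"
proof -
  have "Max ((\<lambda>e. Q (\<xi> e)) ` set (path_edges p)) \<in> (\<lambda>e. Q (\<xi> e)) ` set (path_edges p)"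
    using assms by (intro Max_in) auto
  then obtain e where e: "e \<in> set (path_edges p)" "Q (\<xi> e) = Max ((\<lambda>e. Q (\<xi> e)) ` set (path_edges p))"
    by auto
  have "sum_list (map (\<tau> \<xi>) (path_edges p)) \<le> sum_list (map (\<lambda>_. Q (\<xi> e)) (path_edges p))"
  proof (rule sum_list_mono)
    fix e' assume "e' \<in> set (path_edges p)"
    then have "Q (\<xi> e') \<le> Q (\<xi> e)" by (simp add: e)
    then show "\<tau> \<xi> e' \<le> Q (\<xi> e)" using w_le_Q unfolding column_weights_def by (rule order_trans[rotated])
  qed
  then show ?thesis using e(1) by (auto simp: path_weight_eq_sum_list sum_list_triv)
qed

text \<open>Each path costs at most \<open>L\<close> times the envelope of its worst edge. The four
  worst edges depend on \<open>\<xi>\<close>, so the bound sums over all quadruples with one edge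
  from each path; disjointness makes the four edges distinct.\<close>

lemma good_paths_four:
  assumes path: "is_path u v p1" "is_path u v p2" "is_path u v p3" "is_path u v p4"
    and ne: "path_edges p1 \<noteq> []" "path_edges p2 \<noteq> []" "path_edges p3 \<noteq> []" "path_edges p4 \<noteq> []"
    and disj: "set (path_edges p1) \<inter> set (path_edges p2) = {}" "set (path_edges p1) \<inter> set (path_edges p3) = {}"
      "set (path_edges p1) \<inter> set (path_edges p4) = {}" "set (path_edges p2) \<inter> set (path_edges p3) = {}"
      "set (path_edges p2) \<inter> set (path_edges p4) = {}" "set (path_edges p3) \<inter> set (path_edges p4) = {}"
  shows "good_paths u v {p1, p2, p3, p4}"
proof -
  let ?E = "set (path_edges p1) \<times> set (path_edges p2) \<times> set (path_edges p3) \<times> set (path_edges p4)"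
  let ?m = "\<lambda>\<xi> (e1, e2, e3, e4). min (min (Q (\<xi> e1)) (Q (\<xi> e2))) (min (Q (\<xi> e3)) (Q (\<xi> e4)))"
  define L where "L = real (length (path_edges p1) + length (path_edges p2) + length (path_edges p3) + length (path_edges p4))"
  show ?thesis
  proof (rule good_pathsI)
    show "integrable edge_measure (\<lambda>\<xi>. L * (\<Sum>s\<in>?E. ?m \<xi> s))"
    proof (intro integrable_mult_right Bochner_Integration.integrable_sum)
      fix s assume "s \<in> ?E"
      then obtain e1 e2 e3 e4 where s: "s = (e1, e2, e3, e4)" "e1 \<in> set (path_edges p1)"
        "e2 \<in> set (path_edges p2)" "e3 \<in> set (path_edges p3)" "e4 \<in> set (path_edges p4)" by auto
      then have "distinct [e1, e2, e3, e4]" using disj by auto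
      from Q_integrable[OF this] show "integrable edge_measure (\<lambda>\<xi>. ?m \<xi> s)" by (simp add: s)
    qed
    fix \<xi>
    obtain e1 e2 e3 e4 where e: "e1 \<in> set (path_edges p1)" "e2 \<in> set (path_edges p2)" "e3 \<in> set (path_edges p3)"
        "e4 \<in> set (path_edges p4)"
      and le: "path_weight (\<tau> \<xi>) p1 \<le> length (path_edges p1) * Q (\<xi> e1)"
        "path_weight (\<tau> \<xi>) p2 \<le> length (path_edges p2) * Q (\<xi> e2)"
        "path_weight (\<tau> \<xi>) p3 \<le> length (path_edges p3) * Q (\<xi> e3)"
        "path_weight (\<tau> \<xi>) p4 \<le> length (path_edges p4) * Q (\<xi> e4)"
      using ne path_weight_le_max by metis
    have "length (path_edges p1) * Q (\<xi> e1) \<le> L * Q (\<xi> e1)" "length (path_edges p2) * Q (\<xi> e2) \<le> L * Q (\<xi> e2)"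
      "length (path_edges p3) * Q (\<xi> e3) \<le> L * Q (\<xi> e3)" "length (path_edges p4) * Q (\<xi> e4) \<le> L * Q (\<xi> e4)"
      by (auto simp: L_def intro!: mult_right_mono Q_nonneg)
    with le have "path_weight (\<tau> \<xi>) p1 \<le> L * Q (\<xi> e1)" "path_weight (\<tau> \<xi>) p2 \<le> L * Q (\<xi> e2)"
      "path_weight (\<tau> \<xi>) p3 \<le> L * Q (\<xi> e3)" "path_weight (\<tau> \<xi>) p4 \<le> L * Q (\<xi> e4)"
      by linarith+
    then have "min_weight (\<tau> \<xi>) {p1, p2, p3, p4} \<le> L * ?m \<xi> (e1, e2, e3, e4)"
      unfolding min_weight_def by (auto simp: min_def)
    also have "\<dots> \<le> L * (\<Sum>s\<in>?E. ?m \<xi> s)"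
    proof (rule mult_left_mono)
      show "?m \<xi> (e1, e2, e3, e4) \<le> (\<Sum>s\<in>?E. ?m \<xi> s)"
        using e by (intro member_le_sum) (auto simp: Q_nonneg)
    qed (simp add: L_def)
    finally show "min_weight (\<tau> \<xi>) {p1, p2, p3, p4} \<le> L * (\<Sum>s\<in>?E. ?m \<xi> s)" .
  qed (use path in auto)
qed

text \<open>Joining minimisers of the two families gives a path whose weight is the sum of the two
  minima.\<close>

lemma good_paths_trans:
  assumes "good_paths u v J" "good_paths v z J'"
  shows "good_paths u z ((\<lambda>(p, q). p @ tl q) ` (J \<times> J'))"
proof (rule good_pathsI)
  show "integrable edge_measure (\<lambda>\<xi>. min_weight (\<tau> \<xi>) J + min_weight (\<tau> \<xi>) J')"
    using assms by (auto simp: good_paths_def)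
  show "min_weight (\<tau> \<xi>) ((\<lambda>(p, q). p @ tl q) ` (J \<times> J')) \<le> min_weight (\<tau> \<xi>) J + min_weight (\<tau> \<xi>) J'" for \<xi>
  proof -
    obtain p q where pq: "p \<in> J" "q \<in> J'" "min_weight (\<tau> \<xi>) J = path_weight (\<tau> \<xi>) p"
      "min_weight (\<tau> \<xi>) J' = path_weight (\<tau> \<xi>) q"
      using min_weight_attained assms unfolding good_paths_def by metis
    then have "path_weight (\<tau> \<xi>) p + path_weight (\<tau> \<xi>) q = path_weight (\<tau> \<xi>) (p @ tl q)"
      using assms by (intro path_weight_append[symmetric]) (auto simp: good_paths_def)
    then show ?thesis
      using pq assms by (auto simp: good_paths_def intro!: min_weight_le)
  qed
qed (use assms in \<open>auto simp: good_paths_def intro: is_path_append\<close>)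

text \<open>The explicit lists are four edge-disjoint paths between neighbours.\<close>

lemma ex_good_paths: "\<exists>J. good_paths u v J"
proof (rule lattice_connected[of "\<lambda>u v. \<exists>J. good_paths u v J"])
  show "\<exists>J. good_paths u u J" for u
    by (rule exI[of _ "{[u]}"], rule good_pathsI[where f = "\<lambda>_. 0"])
      (auto simp: is_path_single min_weight_def path_weight_def)
  show "\<exists>J. good_paths u z J" if "\<exists>J. good_paths u v J" "\<exists>J. good_paths v z J" for u v z
    using that good_paths_trans by blast
  fix x y :: int
  note simps = is_path_iff_successively nn_adj_def nn_edge_def
  let ?V = "[[(x,y),(x,y+1)], [(x,y),(x+1,y),(x+1,y+1),(x,y+1)], [(x,y),(x-1,y),(x-1,y+1),(x,y+1)],
    [(x,y),(x,y-1),(x+1,y-1),(x+2,y-1),(x+2,y),(x+2,y+1),(x+2,y+2),(x+1,y+2),(x,y+2),(x,y+1)]]"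
  have "good_paths (x, y) (x, y + 1) {?V!0, ?V!1, ?V!2, ?V!3}"
    by (rule good_paths_four) (simp_all add: simps)
  then show "\<exists>J. good_paths (x, y) (x, y + 1) J" ..
  have "good_paths (x, y + 1) (x, y) {rev (?V!0), rev (?V!1), rev (?V!2), rev (?V!3)}"
    by (rule good_paths_four) (simp_all add: simps)
  then show "\<exists>J. good_paths (x, y + 1) (x, y) J" ..
  let ?H = "[[(x,y),(x+1,y)], [(x,y),(x,y+1),(x+1,y+1),(x+1,y)], [(x,y),(x,y-1),(x+1,y-1),(x+1,y)],
    [(x,y),(x-1,y),(x-1,y+1),(x-1,y+2),(x,y+2),(x+1,y+2),(x+2,y+2),(x+2,y+1),(x+2,y),(x+1,y)]]"
  have "good_paths (x, y) (x + 1, y) {?H!0, ?H!1, ?H!2, ?H!3}"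
    by (rule good_paths_four) (simp_all add: simps)
  then show "\<exists>J. good_paths (x, y) (x + 1, y) J" ..
  have "good_paths (x + 1, y) (x, y) {rev (?H!0), rev (?H!1), rev (?H!2), rev (?H!3)}"
    by (rule good_paths_four) (simp_all add: simps)
  then show "\<exists>J. good_paths (x + 1, y) (x, y) J" ..
qed

lemma T_integrable: "integrable edge_measure (\<lambda>\<xi>. T \<xi> u v)"
proof -
  obtain J where J: "good_paths u v J" using ex_good_paths by blast
  show ?thesis
  proof (rule Bochner_Integration.integrable_bound)
    show "integrable edge_measure (\<lambda>\<xi>. min_weight (\<tau> \<xi>) J)" using J by (simp add: good_paths_def)
    have "0 \<le> T \<xi> u v" "T \<xi> u v \<le> min_weight (\<tau> \<xi>) J" for \<xi>
      using J by (auto simp: good_paths_def intro!: passage_time_nonneg passage_time_le_min_weight \<tau>_nonneg)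
    then have "norm (T \<xi> u v) \<le> norm (min_weight (\<tau> \<xi>) J)" for \<xi>
      by (smt (verit) real_norm_def)
    then show "AE \<xi> in edge_measure. norm (T \<xi> u v) \<le> norm (min_weight (\<tau> \<xi>) J)"
      by simp
  qed simp
qed

text \<open>An integrable family \<open>J0\<close> is enlarged along an enumeration of all paths,
  and the minimum over \<open>J0\<close> dominates. Expected passage times are thereby accessible
  through finitely many edges.\<close>

lemma ex_good_paths_approx:
  assumes "0 < \<delta>"
  shows "\<exists>J. good_paths u v J \<and> (\<integral>\<xi>. min_weight (\<tau> \<xi>) J \<partial>edge_measure) \<le> (\<integral>\<xi>. T \<xi> u v \<partial>edge_measure) + \<delta>"
proof -
  obtain J0 where J0: "good_paths u v J0" using ex_good_paths by blast
  have "countable {p. is_path u v p}" by (rule countableI_type)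
  then obtain enum :: "nat \<Rightarrow> vertex list" where enum: "range enum = {p. is_path u v p}"
    using ex_path[of u v] by (metis Collect_empty_eq range_from_nat_into)
  define J where "J k = J0 \<union> enum ` {..<k}" for k
  have J: "good_paths u v (J k)" "finite (J k)" "J k \<noteq> {}" for k
  proof -
    show "good_paths u v (J k)"
      using J0 enum by (intro good_paths_superset[OF J0]) (auto simp: J_def good_paths_def)
    then show "finite (J k)" "J k \<noteq> {}" by (auto simp: good_paths_def)
  qed
  have "incseq J" by (auto simp: incseq_def J_def)
  moreover have "(\<Union>k. J k) = {p. is_path u v p}"
    unfolding enum[symmetric] using J0 enum by (auto simp: J_def good_paths_def)
  ultimately have lim: "(\<lambda>k. min_weight (\<tau> \<xi>) (J k)) \<longlonglongrightarrow> T \<xi> u v" for \<xi>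
    using J by (intro min_weight_tendsto_passage_time \<tau>_nonneg) auto
  have "(\<lambda>k. \<integral>\<xi>. min_weight (\<tau> \<xi>) (J k) \<partial>edge_measure) \<longlonglongrightarrow> (\<integral>\<xi>. T \<xi> u v \<partial>edge_measure)"
  proof (rule integral_dominated_convergence)
    show "integrable edge_measure (\<lambda>\<xi>. min_weight (\<tau> \<xi>) J0)" using J0 by (simp add: good_paths_def)
    show "AE \<xi> in edge_measure. norm (min_weight (\<tau> \<xi>) (J k)) \<le> min_weight (\<tau> \<xi>) J0" for k
    proof (rule AE_I2)
      fix \<xi>
      have "min_weight (\<tau> \<xi>) (J k) \<le> min_weight (\<tau> \<xi>) J0"
        unfolding min_weight_def using J0 J by (intro Min_antimono) (auto simp: good_paths_def J_def)
      then show "norm (min_weight (\<tau> \<xi>) (J k)) \<le> min_weight (\<tau> \<xi>) J0"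
        using min_weight_nonneg[OF \<tau>_nonneg J(2,3)] by simp
    qed
  qed (use lim J in \<open>auto intro!: min_weight_measurable\<close>)
  from order_tendstoD(2)[OF this, of "(\<integral>\<xi>. T \<xi> u v \<partial>edge_measure) + \<delta>"] assms
  obtain k where "(\<integral>\<xi>. min_weight (\<tau> \<xi>) (J k) \<partial>edge_measure) < (\<integral>\<xi>. T \<xi> u v \<partial>edge_measure) + \<delta>"
    by (auto simp: eventually_sequentially)
  with J(1)[of k] show ?thesis by (intro exI[of _ "J k"]) simp
qed

end

section \<open>Almost sure asymptotic bounds in one column\<close>

lemma bounded_div_n_tendsto_0:
  fixes a :: "nat \<Rightarrow> real"
  assumes "\<And>n. \<bar>a n\<bar> \<le> K"
  shows "(\<lambda>n. a n / real n) \<longlonglongrightarrow> 0"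
proof (rule Lim_null_comparison)
  show "\<forall>\<^sub>F n in sequentially. norm (a n / real n) \<le> K / real n"
    using assms by (auto simp: divide_right_mono)
  show "(\<lambda>n. K / real n) \<longlonglongrightarrow> 0" by (rule lim_const_over_n)
qed

text \<open>By invariance the probability that \<open>R (\<theta> n x)\<close> exceeds
  \<open>\<delta> * n\<close> equals that for \<open>R x\<close>. These probabilities are summable
  since \<open>R\<close> is integrable, and Borel--Cantelli applies.\<close>

lemma eventually_stationary_le_linear:
  fixes R :: "'a \<Rightarrow> real"
  assumes "prob_space M" and R: "integrable M R" and \<delta>: "0 < \<delta>"
    and [measurable]: "\<And>n. \<theta> n \<in> measurable M M" and pres: "\<And>n. distr M M (\<theta> n) = M"
  shows "AE x in M. \<forall>\<^sub>F n in sequentially. R (\<theta> n x) \<le> \<delta> * real n"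
proof -
  interpret prob_space M by fact
  note [measurable] = borel_measurable_integrable[OF R]
  let ?A = "\<lambda>n. {x \<in> space M. \<delta> * real n < R (\<theta> n x)}"
  let ?B = "\<lambda>n. {x \<in> space M. \<delta> * real n < R x}"
  have AB: "prob (?A n) = prob (?B n)" for n
  proof -
    have "prob (?B n) = measure (distr M M (\<theta> n)) (?B n)" by (simp add: pres)
    also have "\<dots> = prob (\<theta> n -` ?B n \<inter> space M)" by (intro measure_distr) auto
    also have "\<theta> n -` ?B n \<inter> space M = ?A n"
      using measurable_space[of "\<theta> n" M M] by auto
    finally show ?thesis ..
  qed
  \<comment> \<open>Pointwise form of the tail-sum bound; the summand 1 accounts for
    \<open>n = 0\<close>.\<close>
  have count: "(\<Sum>n<m. indicator (?B n) x) \<le> \<bar>R x\<bar> / \<delta> + 1" if "x \<in> space M" for m x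
  proof -
    have "(\<Sum>n<m. indicator (?B n) x) = real (card {n\<in>{..<m}. \<delta> * real n < R x})"
      using that by (simp add: indicator_def sum.If_cases Int_def)
    also have "\<dots> \<le> real (card {..nat \<lfloor>\<bar>R x\<bar> / \<delta>\<rfloor>})"
    proof (intro of_nat_mono card_mono)
      show "{n\<in>{..<m}. \<delta> * real n < R x} \<subseteq> {..nat \<lfloor>\<bar>R x\<bar> / \<delta>\<rfloor>}"
      proof safe
        fix n assume "\<delta> * real n < R x"
        then have "real n \<le> \<bar>R x\<bar> / \<delta>" using \<delta> by (simp add: pos_le_divide_eq mult.commute)
        then show "n \<le> nat \<lfloor>\<bar>R x\<bar> / \<delta>\<rfloor>" by (simp add: le_nat_floor)
      qed
    qed simp
    also have "\<dots> \<le> \<bar>R x\<bar> / \<delta> + 1"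
      using \<delta> by (simp add: of_nat_floor)
    finally show ?thesis .
  qed
  have "summable (\<lambda>n. prob (?B n))"
  proof (rule summableI_nonneg_bounded)
    fix m
    have "(\<Sum>n<m. prob (?B n)) = (\<integral>x. (\<Sum>n<m. indicator (?B n) x) \<partial>M)"
      by (subst Bochner_Integration.integral_sum) (auto simp: less_top[symmetric])
    also have "\<dots> \<le> (\<integral>x. \<bar>R x\<bar> / \<delta> + 1 \<partial>M)"
      using R count by (intro integral_mono) (auto simp: less_top[symmetric])
    finally show "(\<Sum>n<m. prob (?B n)) \<le> (\<integral>x. \<bar>R x\<bar> / \<delta> + 1 \<partial>M)" .
  qed simp
  then have "summable (\<lambda>n. prob (?A n))" by (simp add: AB)
  then have "AE x in M. \<forall>\<^sub>F n in sequentially. x \<in> space M - ?A n"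
    by (intro borel_cantelli_AE1) (auto simp: less_top[symmetric])
  then show ?thesis
  proof eventually_elim
    fix x assume "\<forall>\<^sub>F n in sequentially. x \<in> space M - ?A n"
    then show "\<forall>\<^sub>F n in sequentially. R (\<theta> n x) \<le> \<delta> * real n"
      by eventually_elim auto
  qed
qed

context column_fpp
begin

text \<open>The one-edge comparison is applied in both directions. The point is that
  \<open>K\<close> serves all targets \<open>v\<close> at once, so the change is negligible after
  division by the distance.\<close>

lemma T_change_edge_bounded:
  "\<exists>K. \<forall>v. \<bar>T (\<xi>(e := x)) u v - T \<xi> u v\<bar> \<le> K"
proof -
  let ?\<xi> = "\<xi>(e := x)"
  have eq: "\<tau> ?\<xi> e' = \<tau> \<xi> e'" if "e' \<noteq> e" for e'
    using that by (simp add: column_weights_def)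
  have "T ?\<xi> u v \<le> T \<xi> u v + (\<Sum>z\<in>edge_ends e. T ?\<xi> u z)" for v
    by (rule passage_time_change_edge[OF \<tau>_nonneg \<tau>_nonneg eq])
  moreover have "T \<xi> u v \<le> T ?\<xi> u v + (\<Sum>z\<in>edge_ends e. T \<xi> u z)" for v
    by (rule passage_time_change_edge[OF \<tau>_nonneg \<tau>_nonneg eq[symmetric]])
  moreover have "0 \<le> (\<Sum>z\<in>edge_ends e. T ?\<xi> u z)" "0 \<le> (\<Sum>z\<in>edge_ends e. T \<xi> u z)"
    by (intro sum_nonneg passage_time_nonneg \<tau>_nonneg)+
  ultimately show ?thesis
    by (intro exI[of _ "(\<Sum>z\<in>edge_ends e. T ?\<xi> u z) + (\<Sum>z\<in>edge_ends e. T \<xi> u z)"])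
      (smt (verit, best))
qed

text \<open>Subadditivity is the triangle inequality through \<open>(0, int m)\<close> combined with
  vertical stationarity. The rate \<open>\<gamma>\<close> is any lower bound for the normalised
  expectations, which allows it to come from another medium.\<close>

lemma T_lower_bound:
  assumes \<gamma>: "\<And>n. \<gamma> * real n \<le> (\<integral>\<xi>. T \<xi> (0, 0) (0, int n) \<partial>edge_measure)" and "c < \<gamma>"
  shows "AE \<xi> in edge_measure. \<forall>\<^sub>F n in sequentially. c * real n \<le> T \<xi> (0, 0) (0, int n)"
  unfolding edge_measure_def
proof (rule PiM_subadditive_liminf[where \<theta> = "\<lambda>i. shift_env (0, int i)" and \<gamma> = \<gamma>],
    unfold edge_measure_def[symmetric])
  show "T \<xi> (0, 0) (0, int (m + n)) \<le> T \<xi> (0, 0) (0, int m) + T (shift_env (0, int m) \<xi>) (0, 0) (0, int n)" for m n \<xi>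
    using passage_time_triangle[OF \<tau>_nonneg, of \<xi> "(0, 0)" "(0, int (m + n))" "(0, int m)"]
      T_shift[of \<xi> "(0, 0)" "int m" "(0, int n)"] by (simp add: add.commute)
  show "(\<lambda>n. (T (\<xi>(e := x)) (0, 0) (0, int n) - T \<xi> (0, 0) (0, int n)) / real n) \<longlonglongrightarrow> 0" for \<xi> e x
  proof -
    obtain K where "\<And>v. \<bar>T (\<xi>(e := x)) (0, 0) v - T \<xi> (0, 0) v\<bar> \<le> K"
      using T_change_edge_bounded[of \<xi> e x "(0, 0)"] by blast
    then show ?thesis by (intro bounded_div_n_tendsto_0)
  qed
  show "T \<xi> (0, 0) (0, int 0) = 0" for \<xi>
    by (simp add: passage_time_self \<tau>_nonneg)
qed (use assms in \<open>auto simp: prob_space_unit_uniform shift_env_distr shift_env_shift_env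
       T_integrable\<close>)

text \<open>The negated partial sums are additive along the shift, so the lower bound for
  subadditive processes becomes an upper bound for averages. The summands may be dependent:
  translates of \<open>J\<close> can share edges.\<close>

lemma min_weight_average_upper_bound:
  assumes J: "good_paths u v J" and k: "1 \<le> k" and d: "(\<integral>\<xi>. min_weight (\<tau> \<xi>) J \<partial>edge_measure) < d"
  shows "AE \<xi> in edge_measure. \<forall>\<^sub>F n in sequentially.
    (\<Sum>i<n. min_weight (\<tau> (shift_env (0, int (k * i)) \<xi>)) J) \<le> d * real n"
proof -
  let ?f = "\<lambda>\<xi>. min_weight (\<tau> \<xi>) J"
  let ?\<theta> = "\<lambda>i. shift_env (0, int (k * i))"
  let ?g = "\<lambda>n \<xi>. - (\<Sum>i<n. ?f (?\<theta> i \<xi>))"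
  have f: "integrable edge_measure ?f" using J by (simp add: good_paths_def)
  have "AE \<xi> in edge_measure. \<forall>\<^sub>F n in sequentially. - d * real n \<le> ?g n \<xi>"
    unfolding edge_measure_def
  proof (rule PiM_subadditive_liminf[where \<theta> = ?\<theta> and \<gamma> = "- (\<integral>\<xi>. ?f \<xi> \<partial>edge_measure)"],
      unfold edge_measure_def[symmetric])
    show add: "?\<theta> (i + j) \<xi> = ?\<theta> j (?\<theta> i \<xi>)" for i j \<xi>
      by (simp add: shift_env_shift_env algebra_simps)
    show "?g (m + n) \<xi> \<le> ?g m \<xi> + ?g n (?\<theta> m \<xi>)" for m n \<xi>
    proof -
      have "(\<Sum>i<m + n. ?f (?\<theta> i \<xi>)) = (\<Sum>i<m. ?f (?\<theta> i \<xi>)) + (\<Sum>i<n. ?f (?\<theta> (m + i) \<xi>))"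
        by (induction n) (simp_all add: algebra_simps)
      then show ?thesis by (simp only: add)
    qed
    show "integrable edge_measure (?g n)" for n
      using integrable_shift_env[OF f] by auto
    show "- (\<integral>\<xi>. ?f \<xi> \<partial>edge_measure) * real n \<le> (\<integral>\<xi>. ?g n \<xi> \<partial>edge_measure)" for n
      using integrable_shift_env[OF f] integral_shift_env[OF f]
      by (simp add: Bochner_Integration.integral_sum)
    show "(\<lambda>n. (?g n (\<xi>(e := x)) - ?g n \<xi>) / real n) \<longlonglongrightarrow> 0" for \<xi> e x
    proof (rule bounded_div_n_tendsto_0)
      fix n
      let ?\<xi> = "\<xi>(e := x)"
      define E where "E = (\<Union>p\<in>J. set (path_edges p))"
      \<comment> \<open>\<open>B\<close> holds the indices whose translate of \<open>J\<close> uses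
        \<open>e\<close>. It is finite because \<open>1 \<le> k\<close> lets each edge of
        \<open>J\<close> reach \<open>e\<close> for at most one index.\<close>
      define B where "B = (\<Union>e'\<in>E. {i. shift_edge (0, int (k * i)) e' = e})"
      have "finite {i. shift_edge (0, int (k * i)) e' = e}" for e'
      proof (rule finite_subset)
        show "{i. shift_edge (0, int (k * i)) e' = e} \<subseteq> {nat ((snd (fst e) - snd (fst e')) div int k)}"
          using k by (auto simp: shift_edge_def)
      qed simp
      then have B: "finite B"
        using J by (auto simp: B_def E_def good_paths_def)
      have eq: "?f (?\<theta> i ?\<xi>) = ?f (?\<theta> i \<xi>)" if "i \<notin> B" for i
      proof (rule min_weight_cong)
        fix p e' assume "p \<in> J" "e' \<in> set (path_edges p)"
        then have "shift_edge (0, int (k * i)) e' \<noteq> e" using that by (auto simp: B_def E_def)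
        then show "\<tau> (?\<theta> i ?\<xi>) e' = \<tau> (?\<theta> i \<xi>) e'"
          by (simp add: column_weights_def shift_env_def)
      qed
      have "\<bar>?g n ?\<xi> - ?g n \<xi>\<bar> = \<bar>\<Sum>i<n. ?f (?\<theta> i \<xi>) - ?f (?\<theta> i ?\<xi>)\<bar>"
        by (simp add: sum_subtractf)
      also have "\<dots> \<le> (\<Sum>i<n. \<bar>?f (?\<theta> i \<xi>) - ?f (?\<theta> i ?\<xi>)\<bar>)" by (rule sum_abs)
      also have "\<dots> = (\<Sum>i\<in>{..<n} \<inter> B. \<bar>?f (?\<theta> i \<xi>) - ?f (?\<theta> i ?\<xi>)\<bar>)"
        by (rule sum.mono_neutral_right) (auto simp: eq simp del: of_nat_mult)
      also have "\<dots> \<le> (\<Sum>i\<in>B. \<bar>?f (?\<theta> i \<xi>) - ?f (?\<theta> i ?\<xi>)\<bar>)"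
        using B by (intro sum_mono2) auto
      finally show "\<bar>?g n ?\<xi> - ?g n \<xi>\<bar> \<le> (\<Sum>i\<in>B. \<bar>?f (?\<theta> i \<xi>) - ?f (?\<theta> i ?\<xi>)\<bar>)" .
    qed
  qed (use d in \<open>auto simp: prob_space_unit_uniform shift_env_distr\<close>)
  then show ?thesis by simp
qed

text \<open>The route goes from the origin to column \<open>x0\<close>, climbs in blocks of height
  \<open>k\<close> along translates of \<open>J\<close>, and returns to column 0 from the top of the
  last complete block.\<close>

lemma T_upper_bound:
  assumes J: "good_paths (x0, 0) (x0, int k) J" and k: "1 \<le> k"
    and c: "(\<integral>\<xi>. min_weight (\<tau> \<xi>) J \<partial>edge_measure) < c * real k"
  shows "AE \<xi> in edge_measure. \<forall>\<^sub>F n in sequentially. T \<xi> (0, 0) (0, int n) \<le> c * real n"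
proof -
  let ?f = "\<lambda>\<xi>. min_weight (\<tau> \<xi>) J"
  let ?\<theta> = "\<lambda>i. shift_env (0, int (k * i))"
  \<comment> \<open>The return starts at height \<open>k * (N div k)\<close> and ends at height
    \<open>N\<close>. Summing over all remainders \<open>r < k\<close> bounds it by one stationary
    sequence.\<close>
  define R where "R \<xi> = (\<Sum>r<k. T \<xi> (x0, 0) (0, int r))" for \<xi>
  define s where "s = (\<integral>\<xi>. ?f \<xi> \<partial>edge_measure)"
  \<comment> \<open>A quarter of the slack: one part each for the block average, the return and the
    first leg, with one to spare.\<close>
  define \<delta> where "\<delta> = (c * real k - s) / 4"
  have \<delta>: "0 < \<delta>" "s + 4 * \<delta> = c * real k" using c by (auto simp: \<delta>_def s_def field_simps)
  have "0 \<le> s"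
    unfolding s_def using J
    by (intro integral_nonneg_AE AE_I2 min_weight_nonneg \<tau>_nonneg) (auto simp: good_paths_def)
  with \<delta> have "0 < c * real k" by linarith
  \<comment> \<open>Positivity of \<open>c\<close> allows \<open>k * (N div k)\<close> to be
    replaced by the larger \<open>N\<close> at the end.\<close>
  then have c0: "0 < c" using k by (simp add: zero_less_mult_iff)
  have block: "T \<xi> (x0, 0) (x0, int (k * n)) \<le> (\<Sum>i<n. ?f (?\<theta> i \<xi>))" for \<xi> n
  proof (induction n)
    case 0
    then show ?case by (simp add: passage_time_self \<tau>_nonneg)
  next
    case (Suc n)
    have "T \<xi> (x0, int (k * n)) (x0, int (k * Suc n)) = T (?\<theta> n \<xi>) (x0, 0) (x0, int k)"
      using T_shift[of \<xi> "(x0, 0)" "int (k * n)" "(x0, int k)"] by (simp add: algebra_simps)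
    also have "\<dots> \<le> ?f (?\<theta> n \<xi>)"
      using J by (intro passage_time_le_min_weight \<tau>_nonneg) (auto simp: good_paths_def)
    finally show ?case
      using Suc passage_time_triangle[OF \<tau>_nonneg, of \<xi> "(x0, 0)" "(x0, int (k * Suc n))" "(x0, int (k * n))"]
      by simp
  qed
  have bound: "T \<xi> (0, 0) (0, int N) \<le> T \<xi> (0, 0) (x0, 0) + (\<Sum>i<N div k. ?f (?\<theta> i \<xi>)) + R (?\<theta> (N div k) \<xi>)" for \<xi> N
  proof -
    have "int (k * (N div k)) + int (N mod k) = int N"
      by (metis mult_div_mod_eq of_nat_add)
    then have "T \<xi> (x0, int (k * (N div k))) (0, int N) = T (?\<theta> (N div k) \<xi>) (x0, 0) (0, int (N mod k))"
      using T_shift[of \<xi> "(x0, 0)" "int (k * (N div k))" "(0, int (N mod k))"] by (simp add: add.commute)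
    also have "\<dots> \<le> R (?\<theta> (N div k) \<xi>)"
      unfolding R_def using k by (intro member_le_sum passage_time_nonneg \<tau>_nonneg) auto
    finally show ?thesis
      using block[of \<xi> "N div k"]
        passage_time_triangle[OF \<tau>_nonneg, of \<xi> "(0, 0)" "(0, int N)" "(x0, 0)"]
        passage_time_triangle[OF \<tau>_nonneg, of \<xi> "(x0, 0)" "(0, int N)" "(x0, int (k * (N div k)))"]
      by linarith
  qed
  have div: "filterlim (\<lambda>N. N div k) sequentially sequentially"
    unfolding filterlim_at_top
  proof
    fix Z
    show "\<forall>\<^sub>F N in sequentially. Z \<le> N div k"
      using eventually_ge_at_top[of "Z * k"]
      by eventually_elim (use k in \<open>simp add: less_eq_div_iff_mult_less_eq\<close>)
  qed
  have "AE \<xi> in edge_measure. \<forall>\<^sub>F n in sequentially. (\<Sum>i<n. ?f (?\<theta> i \<xi>)) \<le> (s + \<delta>) * real n"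
    using \<delta> by (intro min_weight_average_upper_bound[OF J k]) (simp add: s_def)
  moreover have "AE \<xi> in edge_measure. \<forall>\<^sub>F n in sequentially. R (?\<theta> n \<xi>) \<le> \<delta> * real n"
    using \<delta> unfolding R_def
    by (intro eventually_stationary_le_linear prob_space_edge_measure)
      (auto simp: shift_env_distr T_integrable)
  ultimately show ?thesis
  proof eventually_elim
    fix \<xi>
    assume 1: "\<forall>\<^sub>F n in sequentially. (\<Sum>i<n. ?f (?\<theta> i \<xi>)) \<le> (s + \<delta>) * real n"
      and 2: "\<forall>\<^sub>F n in sequentially. R (?\<theta> n \<xi>) \<le> \<delta> * real n"
    obtain m where m: "T \<xi> (0, 0) (x0, 0) \<le> \<delta> * real m"
      using reals_Archimedean3[OF \<delta>(1)] less_imp_le by (metis mult.commute)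
    have "\<forall>\<^sub>F n in sequentially. T \<xi> (0, 0) (x0, 0) + (\<Sum>i<n. ?f (?\<theta> i \<xi>)) + R (?\<theta> n \<xi>) \<le> c * real k * real n"
      using 1 2 eventually_ge_at_top[of m]
    proof eventually_elim
      case (elim n)
      have "\<delta> * real m \<le> \<delta> * real n" using elim \<delta> by simp
      moreover have "(s + \<delta>) * real n + \<delta> * real n + \<delta> * real n \<le> (s + 4 * \<delta>) * real n"
        using \<delta>(1) by (simp add: algebra_simps)
      moreover have "c * real k * real n = (s + 4 * \<delta>) * real n" by (simp add: \<delta>(2))
      ultimately show ?case using elim m by linarith
    qed
    from eventually_compose_filterlim[OF this div]
    show "\<forall>\<^sub>F n in sequentially. T \<xi> (0, 0) (0, int n) \<le> c * real n"
    proof eventually_elim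
      case (elim N)
      have "real k * real (N div k) \<le> real N"
        by (metis mult_div_mod_eq le_add1 of_nat_le_iff of_nat_mult)
      then have "c * real k * real (N div k) \<le> c * real N"
        using c0 by (simp add: mult.assoc)
      with elim bound[of \<xi> N] show ?case by linarith
    qed
  qed
qed

end

section \<open>Quantile functions\<close>

text \<open>Outside \<open>(0, 1)\<close> the infimum defining the quantile may be a junk value, even a negative one.\<close>

definition quantile01 :: "real measure \<Rightarrow> real \<Rightarrow> real" where
  "quantile01 \<nu> u = (if 0 < u \<and> u < 1 then quantile (cdf \<nu>) u else 0)"

section \<open>Inverse transform sampling\<close>

context
  fixes \<nu> :: "real measure"
  assumes \<nu>: "prob_space \<nu>" "sets \<nu> = sets borel"
begin

interpretation cdf_distribution \<nu>
  using \<nu> by (simp add: cdf_distribution_def real_distribution_def real_distribution_axioms_def)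

lemma quantile01_le_iff: "0 < u \<Longrightarrow> u < 1 \<Longrightarrow> quantile01 \<nu> u \<le> x \<longleftrightarrow> u \<le> cdf \<nu> x"
  using pseudoinverse[of u x] by (simp add: quantile01_def quantile_def)

lemma quantile01_mono: "0 < u \<Longrightarrow> u \<le> u' \<Longrightarrow> u' < 1 \<Longrightarrow> quantile01 \<nu> u \<le> quantile01 \<nu> u'"
  using quantile01_le_iff[of u "quantile01 \<nu> u'"] quantile01_le_iff[of u' "quantile01 \<nu> u'"] by auto

lemma quantile01_measurable [measurable]: "quantile01 \<nu> \<in> borel_measurable borel"
proof -
  have "(\<lambda>u. if u \<in> {0<..<1} then quantile (cdf \<nu>) u else 0) \<in> borel_measurable borel"
    using measurable_CI by (subst measurable_restrict_space_iff[symmetric]) (auto simp: quantile_def[abs_def])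
  then show ?thesis by (simp add: quantile01_def[abs_def])
qed

text \<open>The default values cause no trouble: for \<open>u \<le> 0\<close> the set in the
  definition is always \<open>UNIV\<close>, for \<open>1 < u\<close> it is always empty, and
  \<open>u = 1\<close> is a single point.\<close>

lemma quantile_measurable [measurable]: "quantile (cdf \<nu>) \<in> borel_measurable borel"
proof -
  define K0 :: real where "K0 = Inf UNIV"
  define K1 :: real where "K1 = Inf {}"
  have 0: "quantile (cdf \<nu>) u = K0" if "u \<le> 0" for u
  proof -
    have "{x. u \<le> cdf \<nu> x} = UNIV" using that cdf_nonneg order_trans by blast
    then show ?thesis by (simp add: quantile_def K0_def)
  qed
  have 1: "quantile (cdf \<nu>) u = K1" if "1 < u" for u
  proof -
    have "{x. u \<le> cdf \<nu> x} = {}" using that cdf_bounded_prob le_less_trans not_less by blast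
    then show ?thesis by (simp add: quantile_def K1_def)
  qed
  have "quantile (cdf \<nu>) = (\<lambda>u. if u \<le> 0 then K0 else if u < 1 then quantile01 \<nu> u
      else if u = 1 then quantile (cdf \<nu>) 1 else K1)"
    using 0 1 by (auto simp: fun_eq_iff quantile01_def)
  also have "\<dots> \<in> borel_measurable borel" by measurable
  finally show ?thesis .
qed

lemma quantile01_nonneg:
  assumes "emeasure \<nu> {..<0} = 0" shows "0 \<le> quantile01 \<nu> u"
proof (rule ccontr)
  let ?x = "quantile01 \<nu> u"
  assume "\<not> 0 \<le> ?x"
  then have u: "0 < u" "u < 1" and x: "?x < 0" by (auto simp: quantile01_def split: if_splits)
  have "u \<le> cdf \<nu> ?x" using quantile01_le_iff[OF u, of ?x] by simp
  also have "\<dots> \<le> measure \<nu> {..<0}"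
    unfolding cdf_def using x by (intro finite_measure_mono) auto
  also have "\<dots> = 0" using assms by (simp add: measure_def)
  finally show False using u by simp
qed

text \<open>The endpoints 0 and 1 are Lebesgue null, and on the open interval
  \<open>quantile01 \<nu>\<close> is the pseudo-inverse \<open>I\<close> of the distribution
  function.\<close>

lemma distr_quantile01: "distr (uniform_measure lborel {0..1}) borel (quantile01 \<nu>) = \<nu>"
proof (rule measure_eqI)
  fix A assume "A \<in> sets (distr (uniform_measure lborel {0..1}) borel (quantile01 \<nu>))"
  then have A [measurable]: "A \<in> sets borel" by simp
  have "quantile01 \<nu> \<in> borel_measurable (uniform_measure lborel {0..1})"
    using quantile01_measurable by (simp cong: measurable_cong_sets)
  from emeasure_distr[OF this A]
  have "emeasure (distr (uniform_measure lborel {0..1}) borel (quantile01 \<nu>)) A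
      = emeasure lborel ({0..1} \<inter> quantile01 \<nu> -` A)"
    using measurable_sets_borel[OF quantile01_measurable A] by (simp add: divide_ennreal_def)
  also have "\<dots> = emeasure lborel ({0<..<1} \<inter> quantile01 \<nu> -` A)"
  proof (rule emeasure_eq_AE)
    show "AE x in lborel. x \<in> {0..1} \<inter> quantile01 \<nu> -` A \<longleftrightarrow> x \<in> {0<..<1} \<inter> quantile01 \<nu> -` A"
      using AE_lborel_singleton[of 0] AE_lborel_singleton[of 1] by eventually_elim auto
  qed (use measurable_sets_borel[OF quantile01_measurable A] in auto)
  also have "{0<..<1} \<inter> quantile01 \<nu> -` A = {0<..<1} \<inter> I -` A"
    by (auto simp: quantile01_def quantile_def)
  also have "emeasure lborel \<dots> = emeasure (distr (restrict_space lborel {0<..<1}) borel I) A"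
  proof -
    have [measurable]: "I \<in> borel_measurable (restrict_space lborel {0<..<1})"
      using measurable_CI by (simp cong: measurable_cong_sets add: sets_restrict_space)
    show ?thesis
      by (simp add: emeasure_distr emeasure_restrict_space space_restrict_space Int_commute)
  qed
  also have "\<dots> = emeasure \<nu> A" by (simp add: distr_I_eq_M)
  finally show "emeasure (distr (uniform_measure lborel {0..1}) borel (quantile01 \<nu>)) A = emeasure \<nu> A" .
qed (use \<nu> in simp)

text \<open>Distinct edges carry independent uniform variables, whose quantiles are independent with
  law \<open>\<nu>\<close>. The integral is thus the one in \<open>finite_EY\<close>.\<close>

lemma integrable_min_four_quantile01:
  assumes 0: "emeasure \<nu> {..<0} = 0" and EY: "finite_EY \<nu>" and e: "distinct [e1, e2, e3, e4]"
  shows "integrable edge_measure (\<lambda>\<xi>. min (min (quantile01 \<nu> (\<xi> e1)) (quantile01 \<nu> (\<xi> e2)))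
      (min (quantile01 \<nu> (\<xi> e3)) (quantile01 \<nu> (\<xi> e4))))"
proof -
  let ?U = "uniform_measure lborel {0..1::real}" and ?I = "{0..<4::nat}"
  let ?m = "\<lambda>z. ennreal (min (min (z 0) (z 1)) (min (z 2) (z 3)))"
  let ?e = "\<lambda>i. [e1, e2, e3, e4] ! i"
  let ?h = "\<lambda>\<xi>. \<lambda>n\<in>?I. \<xi> (?e n)"
  have 4: "(0::nat) \<in> ?I" "(1::nat) \<in> ?I" "(2::nat) \<in> ?I" "(3::nat) \<in> ?I" by auto
  have U: "prob_space ?U" by (rule prob_space_unit_uniform)
  have qU: "quantile01 \<nu> \<in> measurable ?U \<nu>"
    using quantile01_measurable \<nu>(2) by (simp cong: measurable_cong_sets)
  have dU: "distr ?U \<nu> (quantile01 \<nu>) = \<nu>"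
    using distr_quantile01 \<nu>(2) by (metis distr_cong)
  have "inj_on ?e ?I"
    using e by (simp add: inj_on_nth)
  then have reindex: "distr edge_measure (PiM ?I (\<lambda>_. ?U)) ?h = PiM ?I (\<lambda>_. ?U)"
    unfolding edge_measure_def using U by (intro distr_PiM_reindex[of UNIV "\<lambda>_. ?U"]) auto
  have h: "?h \<in> measurable edge_measure (PiM ?I (\<lambda>_. ?U))"
    unfolding edge_measure_def by measurable
  have comp: "distr (PiM ?I (\<lambda>_. ?U)) (PiM ?I (\<lambda>_. \<nu>)) (compose ?I (quantile01 \<nu>)) = PiM ?I (\<lambda>_. \<nu>)"
    using distr_PiM_finite_prob_space'[of ?I "\<lambda>_. ?U" "\<lambda>_. \<nu>" "quantile01 \<nu>"] U \<nu>(1) qU dU by simp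
  have c: "compose ?I (quantile01 \<nu>) \<in> measurable (PiM ?I (\<lambda>_. ?U)) (PiM ?I (\<lambda>_. \<nu>))"
    unfolding compose_def using qU by measurable
  have mm: "?m \<in> borel_measurable (PiM ?I (\<lambda>_. \<nu>))"
  proof -
    have "(\<lambda>z. z i) \<in> borel_measurable (PiM ?I (\<lambda>_. \<nu>))" if "i \<in> ?I" for i
      using measurable_component_singleton[OF that, of "\<lambda>_. \<nu>"] \<nu>(2) by (simp cong: measurable_cong_sets)
    from this[OF 4(1)] this[OF 4(2)] this[OF 4(3)] this[OF 4(4)] show ?thesis by measurable
  qed
  have "(\<integral>\<^sup>+z. ?m z \<partial>PiM ?I (\<lambda>_. \<nu>)) = (\<integral>\<^sup>+z. ?m (compose ?I (quantile01 \<nu>) z) \<partial>PiM ?I (\<lambda>_. ?U))"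
    using nn_integral_distr[OF c, of ?m] mm by (simp add: comp)
  also have "\<dots> = (\<integral>\<^sup>+\<xi>. ?m (compose ?I (quantile01 \<nu>) (?h \<xi>)) \<partial>edge_measure)"
    using nn_integral_distr[OF h, of "\<lambda>z. ?m (compose ?I (quantile01 \<nu>) z)"] measurable_compose[OF c mm]
    by (simp add: reindex)
  also have "\<dots> = (\<integral>\<^sup>+\<xi>. ennreal (min (min (quantile01 \<nu> (\<xi> e1)) (quantile01 \<nu> (\<xi> e2)))
      (min (quantile01 \<nu> (\<xi> e3)) (quantile01 \<nu> (\<xi> e4)))) \<partial>edge_measure)"
    by (simp add: compose_def numeral_eq_Suc)
  finally show ?thesis
    using EY quantile01_nonneg[OF 0] by (intro integrableI_nonneg) (auto simp: finite_EY_def)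
qed

end

text \<open>Both quantile functions are monotone, so the smallest of the four uniform variables
  simultaneously minimises them.\<close>

lemma min_four_max_quantile01_le:
  assumes "prob_space \<nu>" "sets \<nu> = sets borel" "emeasure \<nu> {..<0} = 0"
    and "prob_space \<nu>'" "sets \<nu>' = sets borel" "emeasure \<nu>' {..<0} = 0"
  defines "Q \<equiv> \<lambda>u. max (quantile01 \<nu> u) (quantile01 \<nu>' u)"
  shows "min (min (Q a) (Q b)) (min (Q c) (Q d))
    \<le> min (min (quantile01 \<nu> a) (quantile01 \<nu> b)) (min (quantile01 \<nu> c) (quantile01 \<nu> d))
      + min (min (quantile01 \<nu>' a) (quantile01 \<nu>' b)) (min (quantile01 \<nu>' c) (quantile01 \<nu>' d))"
proof -
  define S where "S = {a, b, c, d}"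
  have S: "finite S" "S \<noteq> {}" by (auto simp: S_def)
  have m: "min (min (f a) (f b)) (min (f c) (f d)) = Min (f ` S)" for f :: "real \<Rightarrow> real"
    by (simp add: S_def min.assoc)
  have nonneg: "0 \<le> quantile01 \<nu> u" "0 \<le> quantile01 \<nu>' u" for u
    using assms quantile01_nonneg by auto
  show ?thesis
  proof (cases "S \<subseteq> {0<..<1}")
    case True
    define u where "u = Min S"
    have u: "u \<in> S" "\<And>v. v \<in> S \<Longrightarrow> u \<le> v" using S by (auto simp: u_def)
    have "quantile01 \<nu> u \<le> quantile01 \<nu> v" "quantile01 \<nu>' u \<le> quantile01 \<nu>' v" if "v \<in> S" for v
      using assms True u that by (auto intro!: quantile01_mono)
    then have "quantile01 \<nu> u \<le> Min (quantile01 \<nu> ` S)" "quantile01 \<nu>' u \<le> Min (quantile01 \<nu>' ` S)"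
      using S by auto
    moreover have "Min (Q ` S) \<le> Q u" using S u by auto
    moreover have "Q u \<le> quantile01 \<nu> u + quantile01 \<nu>' u"
      using nonneg[of u] by (simp add: Q_def)
    ultimately show ?thesis unfolding m by linarith
  next
    \<comment> \<open>Outside \<open>(0, 1)\<close> both functions vanish by definition, so the
      minimum of \<open>Q\<close> is at most zero.\<close>
    case False
    then obtain v where "v \<in> S" "v \<notin> {0<..<1}" by blast
    then have "Q v = 0" by (auto simp: Q_def quantile01_def)
    then have "Min (Q ` S) \<le> 0" using S \<open>v \<in> S\<close> by (metis Min_le finite_imageI image_eqI)
    moreover have "0 \<le> Min (quantile01 \<nu> ` S)" "0 \<le> Min (quantile01 \<nu>' ` S)"
      using S nonneg by auto
    ultimately show ?thesis unfolding m by linarith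
  qed
qed

section \<open>Comparison under concave domination\<close>

text \<open>A path may use \<open>e\<close> repeatedly, hence the multiplicity. The dependence on
  the weight of \<open>e\<close> is affine with nonnegative slope.\<close>

lemma path_weight_upd:
  "path_weight (\<sigma>(e := t)) p = path_weight (\<sigma>(e := 0)) p + real (count_list (path_edges p) e) * t"
proof -
  have "sum_list (map (\<sigma>(e := t)) es) = sum_list (map (\<sigma>(e := 0)) es) + real (count_list es e) * t" for es
    by (induction es) (auto simp: algebra_simps)
  then show ?thesis by (simp add: path_weight_eq_sum_list)
qed

text \<open>Both properties come from a minimum of a constant and finitely many nondecreasing affine
  functions. The truncation at \<open>m\<close> supplies the integrability required by
  \<open>conc_dom\<close>.\<close>

lemma
  fixes m :: real and \<sigma> :: "edge \<Rightarrow> real" and e :: edge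
  assumes J: "finite J" "J \<noteq> {}"
  defines "\<phi> \<equiv> \<lambda>t. min m (min_weight (\<sigma>(e := t)) J)"
  shows concave_min_weight_upd: "concave_on UNIV \<phi>" and mono_min_weight_upd: "mono \<phi>"
proof -
  have le: "\<phi> t \<le> path_weight (\<sigma>(e := t)) p" if "p \<in> J" for t p
    unfolding \<phi>_def using min_weight_le[OF J(1) that] by (intro min.coboundedI2)
  have att: "\<phi> t = m \<or> (\<exists>p\<in>J. \<phi> t = path_weight (\<sigma>(e := t)) p)" for t
    using min_weight_attained[OF J, of "\<sigma>(e := t)"] by (auto simp: \<phi>_def min_def)
  have le_m: "\<phi> t \<le> m" for t by (simp add: \<phi>_def)
  show "mono \<phi>"
  proof (rule monoI)
    fix s t :: real assume "s \<le> t"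
    show "\<phi> s \<le> \<phi> t"
      using att[of t]
    proof
      assume "\<exists>p\<in>J. \<phi> t = path_weight (\<sigma>(e := t)) p"
      then obtain p where p: "p \<in> J" "\<phi> t = path_weight (\<sigma>(e := t)) p" by blast
      have "path_weight (\<sigma>(e := s)) p \<le> path_weight (\<sigma>(e := t)) p"
        unfolding path_weight_upd[of \<sigma> e s] path_weight_upd[of \<sigma> e t]
        using \<open>s \<le> t\<close> by (intro add_left_mono mult_left_mono) auto
      with le[OF p(1), of s] p(2) show ?thesis by simp
    qed (simp add: le_m)
  qed
  show "concave_on UNIV \<phi>"
    unfolding concave_on_iff
  proof (intro conjI convex_UNIV ballI allI impI)
    fix x y u v :: real assume uv: "0 \<le> u" "0 \<le> v" "u + v = 1"
    define z where "z = u *\<^sub>R x + v *\<^sub>R y"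
    from att[of z] have "u * \<phi> x + v * \<phi> y \<le> \<phi> z"
    proof
      assume "\<phi> z = m"
      moreover have "u * \<phi> x + v * \<phi> y \<le> u * m + v * m"
        using uv le_m by (intro add_mono mult_left_mono) auto
      moreover have "u * m + v * m = m" using uv by (simp flip: distrib_right)
      ultimately show ?thesis by simp
    next
      assume "\<exists>p\<in>J. \<phi> z = path_weight (\<sigma>(e := z)) p"
      then obtain p where p: "p \<in> J" "\<phi> z = path_weight (\<sigma>(e := z)) p" by blast
      define a k where "a = path_weight (\<sigma>(e := 0)) p" and "k = real (count_list (path_edges p) e)"
      have pw: "path_weight (\<sigma>(e := t)) p = a + k * t" for t
        unfolding a_def k_def by (rule path_weight_upd)
      have "u * \<phi> x + v * \<phi> y \<le> u * (a + k * x) + v * (a + k * y)"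
        using uv le[OF p(1)] by (intro add_mono mult_left_mono) (auto simp: pw)
      also have "\<dots> = (u + v) * a + k * z" by (simp add: z_def algebra_simps)
      also have "\<dots> = \<phi> z" using uv p(2) by (simp add: pw)
      finally show ?thesis .
    qed
    then show "u * \<phi> x + v * \<phi> y \<le> \<phi> (u *\<^sub>R x + v *\<^sub>R y)" by (simp only: z_def)
  qed
qed

context
  fixes \<nu> \<nu>0 :: "real measure"
  assumes \<nu>: "prob_space \<nu>" "sets \<nu> = sets borel" "emeasure \<nu> {..<0} = 0"
    and \<nu>0: "prob_space \<nu>0" "sets \<nu>0 = sets borel" "emeasure \<nu>0 {..<0} = 0"
    and dom: "conc_dom \<nu>0 \<nu>"
begin

text \<open>Both measures live on the nonnegative half-line, where \<open>\<phi>\<close> takes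
  values between 0 and \<open>m\<close>; hence \<open>\<phi>\<close> is integrable for both and
  \<open>conc_dom\<close> applies. The inverse transform carries the inequality to uniform
  variables.\<close>

lemma nn_integral_quantile01_concave_le:
  fixes \<phi> :: "real \<Rightarrow> real"
  assumes \<phi>: "concave_on UNIV \<phi>" "mono \<phi>" "\<And>t. 0 \<le> t \<Longrightarrow> 0 \<le> \<phi> t" "\<And>t. \<phi> t \<le> m"
  shows "(\<integral>\<^sup>+u. ennreal (\<phi> (quantile01 \<nu>0 u)) \<partial>uniform_measure lborel {0..1})
    \<le> (\<integral>\<^sup>+u. ennreal (\<phi> (quantile01 \<nu> u)) \<partial>uniform_measure lborel {0..1})"
proof -
  have [measurable]: "\<phi> \<in> borel_measurable borel" by (rule borel_measurable_mono[OF \<phi>(2)])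
  have *: "(\<integral>\<^sup>+u. ennreal (\<phi> (quantile01 \<mu> u)) \<partial>uniform_measure lborel {0..1}) = ennreal (\<integral>x. \<phi> x \<partial>\<mu>)
      \<and> integrable \<mu> \<phi>"
    if \<mu>: "prob_space \<mu>" "sets \<mu> = sets borel" "emeasure \<mu> {..<0} = 0" for \<mu>
  proof -
    interpret prob_space \<mu> by fact
    have [measurable_cong]: "sets \<mu> = sets borel" by fact
    have "AE x in \<mu>. x \<notin> {..<0}"
      using \<mu> by (intro AE_not_in) (auto simp: null_sets_def)
    then have pos: "AE x in \<mu>. 0 \<le> \<phi> x"
      by eventually_elim (auto intro: \<phi>)
    have int: "integrable \<mu> \<phi>"
    proof (rule integrable_const_bound[where B = m])
      show "AE x in \<mu>. norm (\<phi> x) \<le> m" using pos by eventually_elim (auto simp: \<phi>)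
    qed (use borel_measurable_mono[OF \<phi>(2)] \<mu>(2) in \<open>simp cong: measurable_cong_sets\<close>)
    have q: "quantile01 \<mu> \<in> borel_measurable (uniform_measure lborel {0..1})"
      using quantile01_measurable[OF \<mu>(1,2)] by (simp cong: measurable_cong_sets)
    have "(\<integral>\<^sup>+u. ennreal (\<phi> (quantile01 \<mu> u)) \<partial>uniform_measure lborel {0..1})
        = (\<integral>\<^sup>+x. ennreal (\<phi> x) \<partial>distr (uniform_measure lborel {0..1}) borel (quantile01 \<mu>))"
      using q by (subst nn_integral_distr) auto
    also have "\<dots> = ennreal (\<integral>x. \<phi> x \<partial>\<mu>)"
      using int pos by (simp add: distr_quantile01[OF \<mu>(1,2)] nn_integral_eq_integral)
    finally show ?thesis using int by simp
  qed
  have "(\<integral>x. \<phi> x \<partial>\<nu>0) \<le> (\<integral>x. \<phi> x \<partial>\<nu>)"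
    using dom \<phi> *[OF \<nu>] *[OF \<nu>0] unfolding conc_dom_def by blast
  then show ?thesis using *[OF \<nu>] *[OF \<nu>0] by (simp add: ennreal_leI)
qed

text \<open>Edges are switched to \<open>\<nu>0\<close> one after another. Resampling
  \<open>e\<close> freezes all other weights and leaves a concave nondecreasing function of one
  weight. Only the finitely many edges used by \<open>J\<close> matter.\<close>

lemma nn_integral_min_weight_le:
  assumes J: "finite J" "J \<noteq> {}"
    and W: "\<And>e. W e \<in> {quantile01 \<nu>, quantile01 \<nu>0}"
  shows "(\<integral>\<^sup>+\<xi>. ennreal (min m (min_weight (\<lambda>e. quantile01 \<nu>0 (\<xi> e)) J)) \<partial>edge_measure)
    \<le> (\<integral>\<^sup>+\<xi>. ennreal (min m (min_weight (\<lambda>e. W e (\<xi> e)) J)) \<partial>edge_measure)"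
proof -
  let ?U = "uniform_measure lborel {0..1::real}"
  \<comment> \<open>\<open>D\<close> is the set of edges already switched.\<close>
  define V where "V D e = (if e \<in> D then quantile01 \<nu>0 else W e)" for D e
  define F where "F D \<xi> = ennreal (min m (min_weight (\<lambda>e. V D e (\<xi> e)) J))" for D \<xi>
  have V_cases: "V D e = quantile01 \<nu> \<or> V D e = quantile01 \<nu>0" for D e
    using W[of e] by (auto simp: V_def)
  have V_nonneg: "0 \<le> V D e u" for D e u
    using V_cases[of D e] quantile01_nonneg[OF \<nu>] quantile01_nonneg[OF \<nu>0] by auto
  have [measurable]: "V D e \<in> borel_measurable borel" for D e
    using V_cases[of D e] quantile01_measurable[OF \<nu>(1,2)] quantile01_measurable[OF \<nu>0(1,2)] by auto
  have F_measurable: "F D \<in> borel_measurable edge_measure" for D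
    unfolding F_def using borel_measurable_min_weight[of "\<lambda>\<xi> e. V D e (\<xi> e)" edge_measure J] J(1) by measurable
  have step: "(\<integral>\<^sup>+\<xi>. F (insert e D) \<xi> \<partial>edge_measure) \<le> (\<integral>\<^sup>+\<xi>. F D \<xi> \<partial>edge_measure)" for e D
  proof -
    have res: "(\<integral>\<^sup>+\<xi>. F D' \<xi> \<partial>edge_measure) = (\<integral>\<^sup>+\<xi>. \<integral>\<^sup>+u. F D' (\<xi>(e := u)) \<partial>?U \<partial>edge_measure)" for D'
      using nn_integral_PiM_resample[of "\<lambda>_. ?U" "F D'" e] F_measurable[of D'] prob_space_unit_uniform
      by (simp add: edge_measure_def)
    have "(\<integral>\<^sup>+u. F (insert e D) (\<xi>(e := u)) \<partial>?U) \<le> (\<integral>\<^sup>+u. F D (\<xi>(e := u)) \<partial>?U)" for \<xi>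
    proof -
      define \<sigma> where "\<sigma> e' = V D e' (\<xi> e')" for e'
      \<comment> \<open>A negative \<open>m\<close> would spoil nonnegativity of
        \<open>\<phi>\<close>; \<open>max 0 m\<close> gives the same value after
        \<open>ennreal\<close>.\<close>
      define \<phi> where "\<phi> t = min (max 0 m) (min_weight (\<sigma>(e := t)) J)" for t
      have upd: "(\<lambda>e'. V D' e' ((\<xi>(e := u)) e')) = \<sigma>(e := V D' e u)" if "D' = D \<or> D' = insert e D" for D' u
        using that by (auto simp: \<sigma>_def fun_eq_iff V_def)
      have F_eq: "F D' (\<xi>(e := u)) = ennreal (\<phi> (V D' e u))" if "D' = D \<or> D' = insert e D" for D' u
      proof -
        have "0 \<le> min_weight (\<sigma>(e := V D' e u)) J"
          using J V_nonneg by (intro min_weight_nonneg) (auto simp: \<sigma>_def)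
        then show ?thesis unfolding F_def upd[OF that] \<phi>_def
          by (auto simp: min_def max_def ennreal_neg)
      qed
      show ?thesis
      proof (cases "V D e = quantile01 \<nu>0")
        case True
        then have "V (insert e D) e = V D e" by (simp add: V_def)
        then show ?thesis by (simp add: F_eq)
      next
        case False
        then have "V D e = quantile01 \<nu>" using V_cases by blast
        moreover have "V (insert e D) e = quantile01 \<nu>0" by (simp add: V_def)
        moreover have "(\<integral>\<^sup>+u. ennreal (\<phi> (quantile01 \<nu>0 u)) \<partial>?U) \<le> (\<integral>\<^sup>+u. ennreal (\<phi> (quantile01 \<nu> u)) \<partial>?U)"
        proof (rule nn_integral_quantile01_concave_le[where m = "max 0 m"])
          show "concave_on UNIV \<phi>" "mono \<phi>"
            using concave_min_weight_upd[OF J] mono_min_weight_upd[OF J] by (simp_all add: \<phi>_def[abs_def])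
          show "0 \<le> \<phi> t" if "0 \<le> t" for t
            unfolding \<phi>_def using that V_nonneg J
            by (intro min.boundedI min_weight_nonneg) (auto simp: \<sigma>_def)
        qed (simp add: \<phi>_def)
        ultimately show ?thesis by (simp add: F_eq)
      qed
    qed
    then show ?thesis unfolding res by (rule nn_integral_mono)
  qed
  define E where "E = (\<Union>p\<in>J. set (path_edges p))"
  have "finite E" using J by (simp add: E_def)
  then have "(\<integral>\<^sup>+\<xi>. F E \<xi> \<partial>edge_measure) \<le> (\<integral>\<^sup>+\<xi>. F {} \<xi> \<partial>edge_measure)"
    by (induction E rule: finite_induct) (auto intro: order_trans step)
  moreover have "F E \<xi> = ennreal (min m (min_weight (\<lambda>e. quantile01 \<nu>0 (\<xi> e)) J))" for \<xi>
  proof -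
    have "min_weight (\<lambda>e. V E e (\<xi> e)) J = min_weight (\<lambda>e. quantile01 \<nu>0 (\<xi> e)) J"
      by (rule min_weight_cong) (auto simp: V_def E_def)
    then show ?thesis by (simp add: F_def)
  qed
  moreover have "F {} \<xi> = ennreal (min m (min_weight (\<lambda>e. W e (\<xi> e)) J))" for \<xi>
    by (simp add: F_def V_def)
  ultimately show ?thesis by simp
qed

text \<open>The truncation is dropped at once on the right, where it only decreases the integrand,
  and by dominated convergence on the left.\<close>

lemma integral_min_weight_le:
  assumes J: "finite J" "J \<noteq> {}"
    and W: "\<And>e. W e \<in> {quantile01 \<nu>, quantile01 \<nu>0}"
    and int0: "integrable edge_measure (\<lambda>\<xi>. min_weight (\<lambda>e. quantile01 \<nu>0 (\<xi> e)) J)"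
    and int: "integrable edge_measure (\<lambda>\<xi>. min_weight (\<lambda>e. W e (\<xi> e)) J)"
  shows "(\<integral>\<xi>. min_weight (\<lambda>e. quantile01 \<nu>0 (\<xi> e)) J \<partial>edge_measure)
    \<le> (\<integral>\<xi>. min_weight (\<lambda>e. W e (\<xi> e)) J \<partial>edge_measure)"
proof -
  let ?h = "\<lambda>\<xi>. min_weight (\<lambda>e. quantile01 \<nu>0 (\<xi> e)) J" and ?g = "\<lambda>\<xi>. min_weight (\<lambda>e. W e (\<xi> e)) J"
  interpret prob_space edge_measure by (rule prob_space_edge_measure)
  have nonneg: "0 \<le> quantile01 \<nu>0 u" "0 \<le> W e u" for e u
    using W[of e] quantile01_nonneg[OF \<nu>] quantile01_nonneg[OF \<nu>0] by auto
  have f: "0 \<le> ?h \<xi>" "0 \<le> ?g \<xi>" for \<xi>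
    using J nonneg by (auto intro!: min_weight_nonneg)
  have le: "(\<integral>\<xi>. min (real m) (?h \<xi>) \<partial>edge_measure) \<le> (\<integral>\<xi>. ?g \<xi> \<partial>edge_measure)" for m :: nat
  proof -
    have i: "integrable edge_measure (\<lambda>\<xi>. min (real m) (?h \<xi>))" using int0 by simp
    have "ennreal (\<integral>\<xi>. min (real m) (?h \<xi>) \<partial>edge_measure) = (\<integral>\<^sup>+\<xi>. ennreal (min (real m) (?h \<xi>)) \<partial>edge_measure)"
      using f by (intro nn_integral_eq_integral[OF i, symmetric]) auto
    also have "\<dots> \<le> (\<integral>\<^sup>+\<xi>. ennreal (min (real m) (?g \<xi>)) \<partial>edge_measure)"
      by (rule nn_integral_min_weight_le[OF J W])
    also have "\<dots> \<le> (\<integral>\<^sup>+\<xi>. ennreal (?g \<xi>) \<partial>edge_measure)"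
      by (intro nn_integral_mono ennreal_leI) simp
    also have "\<dots> = ennreal (\<integral>\<xi>. ?g \<xi> \<partial>edge_measure)"
      using f by (intro nn_integral_eq_integral[OF int]) auto
    finally show ?thesis
      using f by (simp add: ennreal_le_iff integral_nonneg_AE)
  qed
  have "(\<lambda>m. \<integral>\<xi>. min (real m) (?h \<xi>) \<partial>edge_measure) \<longlonglongrightarrow> (\<integral>\<xi>. ?h \<xi> \<partial>edge_measure)"
  proof (rule integral_dominated_convergence[OF _ _ int0])
    show "AE \<xi> in edge_measure. (\<lambda>m. min (real m) (?h \<xi>)) \<longlonglongrightarrow> ?h \<xi>"
    proof (rule AE_I2)
      fix \<xi>
      obtain m0 :: nat where "?h \<xi> \<le> real m0" using real_arch_simple by blast
      then have "\<forall>\<^sub>F m in sequentially. min (real m) (?h \<xi>) = ?h \<xi>"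
        unfolding eventually_sequentially by (intro exI[of _ m0]) (auto simp: min_def)
      then show "(\<lambda>m. min (real m) (?h \<xi>)) \<longlonglongrightarrow> ?h \<xi>" by (rule tendsto_eventually)
    qed
  qed (use f int0 in auto)
  then show ?thesis using le by (intro LIMSEQ_le_const2) auto
qed

end

section \<open>The columnar environment\<close>

lemma space_env_measure [simp]: "space (env_measure \<epsilon>) = UNIV"
  by (simp add: env_measure_def space_PiM)

lemma measurable_env_coordinate: "(\<lambda>\<eta>. \<eta> x) \<in> measurable (env_measure \<epsilon>) (count_space UNIV)"
proof -
  have "(\<lambda>\<eta>. \<eta> x) \<in> measurable (env_measure \<epsilon>) (measure_pmf (bernoulli_pmf \<epsilon>))"
    unfolding env_measure_def by (rule measurable_component_singleton) simp
  then show ?thesis by (simp cong: measurable_cong_sets)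
qed

lemma prob_space_env_measure: "prob_space (env_measure \<epsilon>)"
  unfolding env_measure_def by (intro prob_space_PiM measure_pmf.prob_space_axioms)

text \<open>The event \<open>A\<close> that infinitely many windows of ones occur ignores each
  single coordinate. Every window has the same positive probability, which bounds the probability of
  \<open>A\<close> from below; the zero-one law does the rest.\<close>

lemma AE_env_measure_run:
  fixes L :: nat
  assumes "0 < \<epsilon>" "\<epsilon> < 1"
  shows "AE \<eta> in env_measure \<epsilon>. \<exists>x0. \<forall>j. \<bar>j\<bar> \<le> int L \<longrightarrow> \<eta> (x0 + j)"
proof -
  interpret prob_space "env_measure \<epsilon>" by (rule prob_space_env_measure)
  interpret PP: product_prob_space "\<lambda>_::int. measure_pmf (bernoulli_pmf \<epsilon>)" UNIV
    by (intro product_prob_spaceI measure_pmf.prob_space_axioms)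
  define R where "R m = {\<eta> :: int \<Rightarrow> bool. \<forall>x\<in>{int m - int L..int m + int L}. \<eta> x}" for m :: nat
  define B where "B N = (\<Union>m\<in>{N..}. R m)" for N
  have R_eq: "R m = {\<eta> \<in> space (env_measure \<epsilon>). \<forall>x\<in>{int m - int L..int m + int L}. \<eta> x \<in> {True}}" for m
    by (simp add: R_def)
  have R_sets [measurable]: "R m \<in> sets (env_measure \<epsilon>)" for m
    unfolding R_eq
    by (intro sets.sets_Collect_finite_All' measurable_sets_Collect[OF measurable_env_coordinate]) auto
  have R_prob: "prob (R m) = \<epsilon> ^ (2 * L + 1)" for m
  proof -
    have "emeasure (env_measure \<epsilon>) (R m) = (\<Prod>x\<in>{int m - int L..int m + int L}. emeasure (measure_pmf (bernoulli_pmf \<epsilon>)) {True})"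
      unfolding R_eq unfolding env_measure_def by (rule PP.emeasure_PiM_Collect) auto
    also have "\<dots> = ennreal (\<epsilon> ^ nat (2 * int L + 1))"
      using assms by (simp add: emeasure_pmf_single ennreal_power)
    also have "nat (2 * int L + 1) = 2 * L + 1" by simp
    finally show ?thesis using assms by (simp add: measure_def)
  qed
  define A where "A = (\<Inter>N. B N)"
  have B_sets: "B N \<in> sets (env_measure \<epsilon>)" for N unfolding B_def by (intro sets.countable_UN') auto
  have A_sets: "A \<in> sets (env_measure \<epsilon>)" unfolding A_def using B_sets by auto
  have "(AE \<eta> in env_measure \<epsilon>. \<eta> \<in> A) \<or> (AE \<eta> in env_measure \<epsilon>. \<eta> \<notin> A)"
    unfolding env_measure_def
  proof (rule PiM_zero_one_law, unfold env_measure_def[symmetric])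
    fix \<eta> :: "int \<Rightarrow> bool" and i x
    have imp: "\<eta>' \<in> A" if "\<eta> \<in> A" "\<And>j. j \<noteq> i \<Longrightarrow> \<eta>' j = \<eta> j" for \<eta> \<eta>' :: "int \<Rightarrow> bool"
      unfolding A_def
    proof
      fix N
      \<comment> \<open>From \<open>i + L + 1\<close> onwards the windows no longer contain the
        altered coordinate \<open>i\<close>.\<close>
      have "\<eta> \<in> B (max N (nat (i + int L + 1)))" using that by (auto simp: A_def)
      then obtain m where m: "m \<ge> N" "int m \<ge> i + int L + 1" "\<eta> \<in> R m" by (auto simp: B_def)
      then have "\<eta>' \<in> R m" using that(2) by (auto simp: R_def)
      with m show "\<eta>' \<in> B N" by (auto simp: B_def)
    qed
    show "\<eta>(i := x) \<in> A \<longleftrightarrow> \<eta> \<in> A"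
      using imp[of \<eta> "\<eta>(i := x)"] imp[of "\<eta>(i := x)" \<eta>] by auto
  qed (use A_sets measure_pmf.prob_space_axioms in auto)
  moreover have "\<not> (AE \<eta> in env_measure \<epsilon>. \<eta> \<notin> A)"
  proof
    assume "AE \<eta> in env_measure \<epsilon>. \<eta> \<notin> A"
    then have 0: "prob A = 0" using prob_eq_0[OF A_sets] by simp
    have "decseq B" unfolding decseq_def B_def by (intro allI impI UN_mono) auto
    then have "(\<lambda>N. prob (B N)) \<longlonglongrightarrow> prob A"
      unfolding A_def using B_sets by (intro finite_Lim_measure_decseq) auto
    moreover have "\<epsilon> ^ (2 * L + 1) \<le> prob (B N)" for N
      unfolding R_prob[of N, symmetric] using B_sets by (intro finite_measure_mono) (auto simp: B_def)
    ultimately have "\<epsilon> ^ (2 * L + 1) \<le> prob A" by (intro LIMSEQ_le_const) auto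
    moreover have "0 < \<epsilon> ^ (2 * L + 1)" using assms by (intro zero_less_power)
    ultimately show False using 0 by linarith
  qed
  ultimately have "AE \<eta> in env_measure \<epsilon>. \<eta> \<in> A" by blast
  then show ?thesis
  proof eventually_elim
    fix \<eta> assume "\<eta> \<in> A"
    then have "\<eta> \<in> B 0" by (auto simp: A_def)
    then obtain m where m: "\<eta> \<in> R m" by (auto simp: B_def)
    show "\<exists>x0. \<forall>j. \<bar>j\<bar> \<le> int L \<longrightarrow> \<eta> (x0 + j)"
    proof (intro exI allI impI)
      fix j assume "\<bar>j\<bar> \<le> int L"
      then have "int m + j \<in> {int m - int L..int m + int L}" by auto
      with m show "\<eta> (int m + j)" unfolding R_def by blast
    qed
  qed
qed

text \<open>On this event \<open>quantile\<close> and \<open>quantile01\<close> agree at every edge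
  variable.\<close>

lemma AE_edge_measure_unit: "AE \<xi> in edge_measure. \<forall>e. 0 < \<xi> e \<and> \<xi> e < 1"
proof -
  have "AE u in uniform_measure lborel {0..1::real}. 0 < u \<and> u < 1"
    using AE_lborel_singleton[of 0] AE_lborel_singleton[of 1]
    by (subst AE_uniform_measure) (auto elim!: eventually_elim2)
  then have "AE \<xi> in edge_measure. 0 < \<xi> e \<and> \<xi> e < 1" for e
    unfolding edge_measure_def
    using AE_PiM_component[of UNIV "\<lambda>_. uniform_measure lborel {0..1::real}" e "\<lambda>u. 0 < u \<and> u < 1"]
      prob_space_unit_uniform by simp
  then show ?thesis by (simp add: AE_all_countable)
qed

definition column_quantile :: "real measure \<Rightarrow> real measure \<Rightarrow> (int \<Rightarrow> bool) \<Rightarrow> int \<Rightarrow> bool \<Rightarrow> real \<Rightarrow> real" where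
  "column_quantile \<nu> \<nu>0 \<eta> x b =
     (if (if b then \<eta> x else \<eta> x \<and> \<eta> (x + 1)) then quantile01 \<nu>0 else quantile01 \<nu>)"

lemma env_weights_eq_column_weights:
  assumes "\<forall>e. 0 < \<xi> e \<and> \<xi> e < 1"
  shows "env_weights (cdf \<nu>) (cdf \<nu>0) \<eta> \<xi> e = column_weights (column_quantile \<nu> \<nu>0 \<eta>) \<xi> e"
proof -
  obtain x y b where e: "e = ((x, y), b)" by (metis surj_pair)
  show ?thesis
    using assms by (cases b) (auto simp: env_weights_def column_weights_def column_quantile_def quantile01_def e)
qed

text \<open>Countably many slopes suffice, so the exceptional null sets of the almost sure bounds
  can be united.\<close>

lemma tendsto_div_nI:
  fixes a :: "nat \<Rightarrow> real"
  assumes lower: "\<And>m. \<forall>\<^sub>F n in sequentially. (c - 1 / real (Suc m)) * real n \<le> a n"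
    and upper: "\<And>m. \<forall>\<^sub>F n in sequentially. a n \<le> (c + 1 / real (Suc m)) * real n"
  shows "(\<lambda>n. a n / real n) \<longlonglongrightarrow> c"
proof (rule order_tendstoI)
  fix b assume "b < c"
  then obtain m where m: "1 / real (Suc m) < c - b"
    using reals_Archimedean[of "c - b"] by (auto simp: inverse_eq_divide)
  from lower[of m] show "\<forall>\<^sub>F n in sequentially. b < a n / real n"
    using eventually_gt_at_top[of 0]
  proof eventually_elim
    case (elim n)
    then have "c - 1 / real (Suc m) \<le> a n / real n" by (simp add: le_divide_eq)
    with m show ?case by simp
  qed
next
  fix b assume "c < b"
  then obtain m where m: "1 / real (Suc m) < b - c"
    using reals_Archimedean[of "b - c"] by (auto simp: inverse_eq_divide)
  from upper[of m] show "\<forall>\<^sub>F n in sequentially. a n / real n < b"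
    using eventually_gt_at_top[of 0]
  proof eventually_elim
    case (elim n)
    then have "a n / real n \<le> c + 1 / real (Suc m)" by (simp add: divide_le_eq)
    with m show ?case by simp
  qed
qed

text \<open>The description operator calls for uniqueness too: for two candidates at distance
  \<open>3 * \<delta>\<close>, the events of deviating by more than \<open>\<delta>\<close> cover
  the space, so their probabilities cannot both tend to zero.\<close>

lemma the_limit_in_probability:
  fixes X :: "nat \<Rightarrow> 'a \<Rightarrow> real"
  assumes "prob_space M" and [measurable]: "\<And>n. X n \<in> borel_measurable M"
    and lim: "AE x in M. (\<lambda>n. X n x) \<longlonglongrightarrow> c"
  shows "(THE c. \<forall>\<delta>>0. (\<lambda>n. measure M {x \<in> space M. \<bar>X n x - c\<bar> > \<delta>}) \<longlonglongrightarrow> 0) = c"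
proof (rule the_equality)
  interpret prob_space M by fact
  let ?A = "\<lambda>n c \<delta>. {x \<in> space M. \<bar>X n x - c\<bar> > \<delta>}"
  show *: "\<forall>\<delta>>0. (\<lambda>n. prob (?A n c \<delta>)) \<longlonglongrightarrow> 0"
  proof (intro allI impI)
    fix \<delta> :: real assume "0 < \<delta>"
    have "(\<lambda>n. \<integral>x. indicator (?A n c \<delta>) x \<partial>M) \<longlonglongrightarrow> (\<integral>x. 0 \<partial>M :: real)"
    proof (rule integral_dominated_convergence[where w = "\<lambda>_. 1"])
      show "AE x in M. (\<lambda>n. indicator (?A n c \<delta>) x :: real) \<longlonglongrightarrow> 0"
        using lim
      proof eventually_elim
        fix x assume "(\<lambda>n. X n x) \<longlonglongrightarrow> c"
        then have "\<forall>\<^sub>F n in sequentially. dist (X n x) c < \<delta>" using \<open>0 < \<delta>\<close> by (rule tendstoD)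
        then have "\<forall>\<^sub>F n in sequentially. indicator (?A n c \<delta>) x = (0 :: real)"
          by eventually_elim (auto simp: dist_real_def)
        then show "(\<lambda>n. indicator (?A n c \<delta>) x :: real) \<longlonglongrightarrow> 0" by (rule tendsto_eventually)
      qed
    qed (auto simp: indicator_def)
    then show "(\<lambda>n. prob (?A n c \<delta>)) \<longlonglongrightarrow> 0" by simp
  qed
  fix c' assume c': "\<forall>\<delta>>0. (\<lambda>n. prob (?A n c' \<delta>)) \<longlonglongrightarrow> 0"
  show "c' = c"
  proof (rule ccontr)
    assume "c' \<noteq> c"
    define \<delta> where "\<delta> = \<bar>c' - c\<bar> / 3"
    have \<delta>: "0 < \<delta>" using \<open>c' \<noteq> c\<close> by (simp add: \<delta>_def)
    have "1 \<le> prob (?A n c \<delta>) + prob (?A n c' \<delta>)" for n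
    proof -
      have "space M \<subseteq> ?A n c \<delta> \<union> ?A n c' \<delta>"
        using \<open>c' \<noteq> c\<close> by (auto simp: \<delta>_def abs_if split: if_splits)
      then have "prob (space M) \<le> prob (?A n c \<delta> \<union> ?A n c' \<delta>)" by (intro finite_measure_mono) auto
      also have "\<dots> \<le> prob (?A n c \<delta>) + prob (?A n c' \<delta>)" by (intro measure_Un_le) auto
      finally show ?thesis by (simp add: prob_space)
    qed
    moreover have "(\<lambda>n. prob (?A n c \<delta>) + prob (?A n c' \<delta>)) \<longlonglongrightarrow> 0 + 0"
      using * c' \<delta> by (intro tendsto_add) auto
    ultimately have "1 \<le> (0::real)" by (intro LIMSEQ_le_const[of _ 0]) auto
    then show False by simp
  qed
qed

section \<open>Identification of the limit with the homogeneous time constant\<close>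

context
  fixes \<nu> \<nu>0 :: "real measure"
  assumes \<nu>: "prob_space \<nu>" "sets \<nu> = sets borel" "emeasure \<nu> {..<0} = 0"
    and \<nu>0: "prob_space \<nu>0" "sets \<nu>0 = sets borel" "emeasure \<nu>0 {..<0} = 0"
    and dom: "conc_dom \<nu>0 \<nu>"
    and EY: "finite_EY \<nu>" "finite_EY \<nu>0"
begin

lemma column_fpp_column_quantile:
  "column_fpp (column_quantile \<nu> \<nu>0 \<eta>) (\<lambda>u. max (quantile01 \<nu> u) (quantile01 \<nu>0 u))"
proof
  note [measurable] = quantile01_measurable[OF \<nu>(1,2)] quantile01_measurable[OF \<nu>0(1,2)]
  let ?Q = "\<lambda>u. max (quantile01 \<nu> u) (quantile01 \<nu>0 u)"
  show "?Q \<in> borel_measurable borel" by measurable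
  show "column_quantile \<nu> \<nu>0 \<eta> x b \<in> borel_measurable borel" for x b
    unfolding column_quantile_def by (auto intro: quantile01_measurable \<nu> \<nu>0)
  show "0 \<le> column_quantile \<nu> \<nu>0 \<eta> x b u" for x b u
    unfolding column_quantile_def using quantile01_nonneg[OF \<nu>] quantile01_nonneg[OF \<nu>0] by auto
  show "column_quantile \<nu> \<nu>0 \<eta> x b u \<le> ?Q u" for x b u
    by (auto simp: column_quantile_def)
  fix e1 e2 e3 e4 :: edge assume e: "distinct [e1, e2, e3, e4]"
  show "integrable edge_measure (\<lambda>\<xi>. min (min (?Q (\<xi> e1)) (?Q (\<xi> e2))) (min (?Q (\<xi> e3)) (?Q (\<xi> e4))))"
  proof (rule Bochner_Integration.integrable_bound)
    show "integrable edge_measure (\<lambda>\<xi>.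
      min (min (quantile01 \<nu> (\<xi> e1)) (quantile01 \<nu> (\<xi> e2))) (min (quantile01 \<nu> (\<xi> e3)) (quantile01 \<nu> (\<xi> e4)))
      + min (min (quantile01 \<nu>0 (\<xi> e1)) (quantile01 \<nu>0 (\<xi> e2))) (min (quantile01 \<nu>0 (\<xi> e3)) (quantile01 \<nu>0 (\<xi> e4))))"
      (is "integrable _ ?f")
      using integrable_min_four_quantile01[OF \<nu> EY(1) e] integrable_min_four_quantile01[OF \<nu>0 EY(2) e]
      by (rule Bochner_Integration.integrable_add)
    have norm_le: "norm a \<le> norm b" if "0 \<le> a" "a \<le> b" for a b :: real using that by simp
    have Q: "0 \<le> ?Q u" for u using quantile01_nonneg[OF \<nu>, of u] by simp
    have "0 \<le> min (min (?Q (\<xi> e1)) (?Q (\<xi> e2))) (min (?Q (\<xi> e3)) (?Q (\<xi> e4)))" for \<xi>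
      using Q by (intro min.boundedI)
    moreover have "min (min (?Q (\<xi> e1)) (?Q (\<xi> e2))) (min (?Q (\<xi> e3)) (?Q (\<xi> e4))) \<le> ?f \<xi>" for \<xi>
      by (rule min_four_max_quantile01_le[OF \<nu> \<nu>0])
    ultimately have "norm (min (min (?Q (\<xi> e1)) (?Q (\<xi> e2))) (min (?Q (\<xi> e3)) (?Q (\<xi> e4)))) \<le> norm (?f \<xi>)" for \<xi>
      by (rule norm_le)
    then show "AE \<xi> in edge_measure. norm (min (min (?Q (\<xi> e1)) (?Q (\<xi> e2))) (min (?Q (\<xi> e3)) (?Q (\<xi> e4)))) \<le> norm (?f \<xi>)"
      by (rule AE_I2)
  qed measurable
qed

interpretation C: column_fpp "column_quantile \<nu> \<nu>0 \<eta>" "\<lambda>u. max (quantile01 \<nu> u) (quantile01 \<nu>0 u)" for \<eta>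
  by (rule column_fpp_column_quantile)

abbreviation (input) all_on :: "int \<Rightarrow> bool" where "all_on \<equiv> \<lambda>_. True"

definition mean_min :: "(int \<Rightarrow> bool) \<Rightarrow> vertex list set \<Rightarrow> real" where
  "mean_min \<eta> J = (\<integral>\<xi>. min_weight (C.\<tau> \<eta> \<xi>) J \<partial>edge_measure)"

text \<open>This is the infimum of the normalised expected passage times in the homogeneous
  \<open>\<nu>0\<close> medium. Finite families are used because they fit into a strip of finitely
  many columns.\<close>

definition path_time_constant :: real where
  "path_time_constant = Inf {mean_min all_on J / real n |n J. 1 \<le> n \<and> C.good_paths all_on (0, 0) (0, int n) J}"

lemma \<tau>_all_on: "C.\<tau> all_on \<xi> = (\<lambda>e. quantile01 \<nu>0 (\<xi> e))"
  by (simp add: column_weights_def column_quantile_def fun_eq_iff)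

lemma mean_min_nonneg: "C.good_paths \<eta> u v J \<Longrightarrow> 0 \<le> mean_min \<eta> J"
  unfolding mean_min_def
  by (intro integral_nonneg_AE AE_I2 min_weight_nonneg C.\<tau>_nonneg) (auto simp: C.good_paths_def)

lemma path_time_constant_le: "1 \<le> n \<Longrightarrow> C.good_paths all_on (0, 0) (0, int n) J \<Longrightarrow> path_time_constant * real n \<le> mean_min all_on J"
proof -
  assume n: "1 \<le> n" "C.good_paths all_on (0, 0) (0, int n) J"
  have "path_time_constant \<le> mean_min all_on J / real n"
    unfolding path_time_constant_def using n
    by (intro cInf_lower) (auto intro!: bdd_belowI[of _ 0] divide_nonneg_nonneg mean_min_nonneg)
  then show ?thesis using n by (simp add: le_divide_eq)
qed

lemma path_time_constant_approx:
  assumes "path_time_constant < c"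
  obtains n J where "1 \<le> n" "C.good_paths all_on (0, 0) (0, int n) J" "mean_min all_on J < c * real n"
proof -
  let ?S = "{mean_min all_on J / real n |n J. 1 \<le> n \<and> C.good_paths all_on (0, 0) (0, int n) J}"
  obtain J where "C.good_paths all_on (0, 0) (0, int 1) J" using C.ex_good_paths by blast
  then have "mean_min all_on J / real 1 \<in> ?S" by blast
  then have ne: "?S \<noteq> {}" by blast
  have bdd: "bdd_below ?S"
    by (auto intro!: bdd_belowI[of _ 0] divide_nonneg_nonneg mean_min_nonneg)
  obtain r where "r \<in> ?S" "r < c"
    using iffD1[OF cInf_less_iff[OF ne bdd] assms[unfolded path_time_constant_def]] by (rule bexE)
  then show ?thesis using that by (auto simp: divide_less_eq)
qed

text \<open>The comparison is made for one finite family that is nearly optimal for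
  \<open>\<eta>\<close> and has integrable minimum in both media.\<close>

lemma path_time_constant_le_expectation: "path_time_constant * real n \<le> (\<integral>\<xi>. C.T \<eta> \<xi> (0, 0) (0, int n) \<partial>edge_measure)"
proof (cases "n = 0")
  case True
  then show ?thesis by (simp add: passage_time_self C.\<tau>_nonneg)
next
  case False
  show ?thesis
  proof (rule field_le_epsilon)
    fix \<delta> :: real assume "0 < \<delta>"
    then obtain J where J: "C.good_paths \<eta> (0, 0) (0, int n) J"
      "mean_min \<eta> J \<le> (\<integral>\<xi>. C.T \<eta> \<xi> (0, 0) (0, int n) \<partial>edge_measure) + \<delta>"
      using C.ex_good_paths_approx unfolding mean_min_def by blast
    \<comment> \<open>\<open>J\<close> is only known to have integrable minimum for
      \<open>\<eta>\<close>. Adding \<open>J1\<close> secures integrability in the homogeneous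
      medium and can only lower the minimum for \<open>\<eta>\<close>.\<close>
    obtain J1 where J1: "C.good_paths all_on (0, 0) (0, int n) J1" using C.ex_good_paths by blast
    let ?J = "J \<union> J1"
    have sub: "finite ?J" "?J \<subseteq> {p. is_path (0, 0) (0, int n) p}"
      using J J1 by (auto simp: C.good_paths_def)
    have g: "C.good_paths \<eta> (0, 0) (0, int n) ?J" "C.good_paths all_on (0, 0) (0, int n) ?J"
      using sub by (intro C.good_paths_superset[OF J(1)] C.good_paths_superset[OF J1]; simp)+
    have "path_time_constant * real n \<le> mean_min all_on ?J" using False g by (intro path_time_constant_le) auto
    also have "\<dots> \<le> mean_min \<eta> ?J"
      unfolding mean_min_def \<tau>_all_on column_weights_def
    proof (rule integral_min_weight_le[OF \<nu> \<nu>0 dom])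
      show "integrable edge_measure (\<lambda>\<xi>. min_weight (\<lambda>e. quantile01 \<nu>0 (\<xi> e)) ?J)"
        using g(2) by (simp add: C.good_paths_def \<tau>_all_on)
      show "integrable edge_measure (\<lambda>\<xi>. min_weight (\<lambda>e. column_quantile \<nu> \<nu>0 \<eta> (fst (fst e)) (snd e) (\<xi> e)) ?J)"
        using g(1) by (simp add: C.good_paths_def column_weights_def[abs_def])
    qed (use g in \<open>auto simp: C.good_paths_def column_quantile_def\<close>)
    also have "\<dots> \<le> mean_min \<eta> J"
      unfolding mean_min_def
    proof (intro integral_mono)
      show "min_weight (C.\<tau> \<eta> \<xi>) ?J \<le> min_weight (C.\<tau> \<eta> \<xi>) J" for \<xi>
        unfolding min_weight_def using J sub by (intro Min_antimono) (auto simp: C.good_paths_def)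
    qed (use J g in \<open>auto simp: C.good_paths_def\<close>)
    finally show "path_time_constant * real n \<le> (\<integral>\<xi>. C.T \<eta> \<xi> (0, 0) (0, int n) \<partial>edge_measure) + \<delta>"
      using J(2) by simp
  qed
qed

text \<open>A nearly optimal family of the homogeneous medium uses finitely many columns. Translated
  into a run of ones that contains them, it has weights with exactly the homogeneous law.\<close>

lemma eventually_le_of_runs:
  assumes run: "\<And>L::nat. \<exists>x0. \<forall>j. \<bar>j\<bar> \<le> int L \<longrightarrow> \<eta> (x0 + j)" and "path_time_constant < c"
  shows "AE \<xi> in edge_measure. \<forall>\<^sub>F n in sequentially. C.T \<eta> \<xi> (0, 0) (0, int n) \<le> c * real n"
proof -
  obtain k J where k: "1 \<le> k" and J: "C.good_paths all_on (0, 0) (0, int k) J"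
    and less: "mean_min all_on J < c * real k"
    using path_time_constant_approx[OF \<open>path_time_constant < c\<close>] .
  define E where "E = (\<Union>p\<in>J. set (path_edges p))"
  have "finite E" using J by (simp add: E_def C.good_paths_def)
  \<comment> \<open>The added 1 is for horizontal edges, whose weight also depends on the column to
    the right.\<close>
  define L where "L = Max (insert 0 ((\<lambda>e. nat \<bar>fst (fst e)\<bar>) ` E)) + 1"
  have L: "\<bar>fst (fst e)\<bar> + 1 \<le> int L" if "e \<in> E" for e
  proof -
    have "nat \<bar>fst (fst e)\<bar> \<le> Max (insert 0 ((\<lambda>e. nat \<bar>fst (fst e)\<bar>) ` E))"
      using \<open>finite E\<close> that by (intro Max_ge) auto
    then show ?thesis by (simp add: L_def)
  qed
  obtain x0 where x0: "\<And>j. \<bar>j\<bar> \<le> int L \<Longrightarrow> \<eta> (x0 + j)" using run[of L] by blast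
  let ?d = "(x0, 0) :: vertex"
  let ?J = "map (\<lambda>a. a + ?d) ` J"
  have eq: "min_weight (C.\<tau> \<eta> \<xi>) ?J = min_weight (C.\<tau> all_on (shift_env ?d \<xi>)) J" for \<xi>
    unfolding min_weight_shift column_weights_shift
  proof (rule min_weight_cong)
    fix p e assume "p \<in> J" "e \<in> set (path_edges p)"
    then have "e \<in> E" by (auto simp: E_def)
    from L[OF this] have "\<eta> (x0 + fst (fst e))" "\<eta> (x0 + (fst (fst e) + 1))"
      by (auto intro!: x0)
    then show "column_weights (\<lambda>x. column_quantile \<nu> \<nu>0 \<eta> (x + fst ?d)) (shift_env ?d \<xi>) e = C.\<tau> all_on (shift_env ?d \<xi>) e"
      by (simp add: column_weights_def column_quantile_def algebra_simps)
  qed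
  have int: "integrable edge_measure (\<lambda>\<xi>. min_weight (C.\<tau> all_on \<xi>) J)"
    using J by (simp add: C.good_paths_def)
  have "C.good_paths \<eta> (x0, 0) (x0, int k) ?J"
    unfolding C.good_paths_def eq using J integrable_shift_env[OF int, of ?d]
      is_path_shift[of "(0, 0)" "(0, int k)" _ ?d]
    by (auto simp: C.good_paths_def)
  moreover have "(\<integral>\<xi>. min_weight (C.\<tau> \<eta> \<xi>) ?J \<partial>edge_measure) < c * real k"
    unfolding eq using less integral_shift_env[OF int, of ?d] by (simp add: mean_min_def)
  ultimately show ?thesis by (intro C.T_upper_bound[OF _ k])
qed

text \<open>The environment is fixed here and only has to contain arbitrarily wide runs of ones.
  This covers almost every \<open>\<eta>\<close> as well as the constant environment.\<close>

lemma T_env_tendsto: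
  assumes run: "\<And>L::nat. \<exists>x0. \<forall>j. \<bar>j\<bar> \<le> int L \<longrightarrow> \<eta> (x0 + j)"
  shows "AE \<xi> in edge_measure. (\<lambda>n. T_env (cdf \<nu>) (cdf \<nu>0) \<eta> \<xi> (0, 0) (0, int n) / real n) \<longlonglongrightarrow> path_time_constant"
proof -
  have "AE \<xi> in edge_measure. \<forall>m. \<forall>\<^sub>F n in sequentially. (path_time_constant - 1 / real (Suc m)) * real n \<le> C.T \<eta> \<xi> (0, 0) (0, int n)"
    unfolding AE_all_countable
    by (intro allI C.T_lower_bound[where \<gamma> = path_time_constant] path_time_constant_le_expectation) simp
  moreover have "AE \<xi> in edge_measure. \<forall>m. \<forall>\<^sub>F n in sequentially. C.T \<eta> \<xi> (0, 0) (0, int n) \<le> (path_time_constant + 1 / real (Suc m)) * real n"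
    unfolding AE_all_countable by (intro allI eventually_le_of_runs run) simp
  ultimately show ?thesis
    using AE_edge_measure_unit
  proof eventually_elim
    case (elim \<xi>)
    have "(\<lambda>n. C.T \<eta> \<xi> (0, 0) (0, int n) / real n) \<longlonglongrightarrow> path_time_constant"
      using elim by (intro tendsto_div_nI) auto
    then show ?case
      unfolding T_env_def
      by (simp only: passage_time_cong[OF env_weights_eq_column_weights[OF elim(3)]])
  qed
qed

text \<open>In the constant environment \<open>T_env\<close> and \<open>T_hom\<close> coincide for
  every \<open>\<xi>\<close>, including default values of \<open>quantile\<close>.\<close>

lemma time_constant_eq_path_time_constant: "time_constant (cdf \<nu>0) (0, 1) = path_time_constant"
proof -
  note [measurable] = quantile_measurable[OF \<nu>0(1,2)]
  have "T_env (cdf \<nu>) (cdf \<nu>0) all_on \<xi> = T_hom (cdf \<nu>0) \<xi>" for \<xi>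
  proof -
    have "env_weights (cdf \<nu>) (cdf \<nu>0) all_on \<xi> = (\<lambda>e. quantile (cdf \<nu>0) (\<xi> e))"
      by (auto simp: env_weights_def fun_eq_iff split: bool.split)
    then show ?thesis unfolding T_env_def[abs_def] T_hom_def[abs_def] by simp
  qed
  with T_env_tendsto[of all_on]
  have "AE \<xi> in edge_measure. (\<lambda>n. T_hom (cdf \<nu>0) \<xi> (0, 0) (0, int n) / real n) \<longlonglongrightarrow> path_time_constant"
    by simp
  moreover have "(\<lambda>\<xi>. T_hom (cdf \<nu>0) \<xi> (0, 0) (0, int n) / real n) \<in> borel_measurable edge_measure" for n
    unfolding T_hom_def by (intro borel_measurable_divide borel_measurable_passage_time) measurable
  ultimately show ?thesis
    unfolding time_constant_def
    using the_limit_in_probability[OF prob_space_edge_measure, of "\<lambda>n \<xi>. T_hom (cdf \<nu>0) \<xi> (0, 0) (0, int n) / real n" path_time_constant]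
    by simp
qed

end

theorem theorem6:
  fixes \<epsilon> :: real and \<nu> \<nu>0 :: "real measure"
  assumes "0 < \<epsilon>" "\<epsilon> < 1"
    and "prob_space \<nu>" "sets \<nu> = sets borel" "emeasure \<nu> {..<0} = 0"
    and "prob_space \<nu>0" "sets \<nu>0 = sets borel" "emeasure \<nu>0 {..<0} = 0"
    and "conc_dom \<nu>0 \<nu>"
    and "finite_EY \<nu>" and "finite_EY \<nu>0"
  shows "AE \<omega> in env_measure \<epsilon> \<Otimes>\<^sub>M edge_measure.
           (\<lambda>n::nat. T_env (cdf \<nu>) (cdf \<nu>0) (fst \<omega>) (snd \<omega>) (0, 0) (0, int n) / real n)
             \<longlonglongrightarrow> time_constant (cdf \<nu>0) (0, 1)"
proof -
  interpret E: prob_space edge_measure by (rule prob_space_edge_measure)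
  interpret N: prob_space "env_measure \<epsilon>" by (rule prob_space_env_measure)
  interpret pair_sigma_finite "env_measure \<epsilon>" edge_measure by unfold_locales
  note \<nu> = assms(3-11)
  let ?X = "\<lambda>n \<omega>. T_env (cdf \<nu>) (cdf \<nu>0) (fst \<omega>) (snd \<omega>) (0, 0) (0, int n) / real n"
  \<comment> \<open>The almost sure statements in \<open>\<eta>\<close> and \<open>\<xi>\<close>
    combine only for a measurable event, whence joint measurability of the weights.\<close>
  have "(\<lambda>\<omega>. env_weights (cdf \<nu>) (cdf \<nu>0) (fst \<omega>) (snd \<omega>) e) \<in> borel_measurable (env_measure \<epsilon> \<Otimes>\<^sub>M edge_measure)" for e
  proof -
    obtain x y b where e: "e = ((x, y), b)" by (metis surj_pair)
    note [measurable] = quantile_measurable[OF assms(3,4)] quantile_measurable[OF assms(6,7)]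
      measurable_compose[OF measurable_fst measurable_env_coordinate]
      measurable_compose[OF measurable_snd measurable_edge_coordinate]
    show ?thesis
      by (cases b) (simp_all add: env_weights_def e)
  qed
  then have "(\<lambda>\<omega>. ?X n \<omega>) \<in> borel_measurable (env_measure \<epsilon> \<Otimes>\<^sub>M edge_measure)" for n
    unfolding T_env_def by (intro borel_measurable_divide borel_measurable_passage_time) auto
  then have "{\<omega> \<in> space (env_measure \<epsilon> \<Otimes>\<^sub>M edge_measure). (\<lambda>n. ?X n \<omega>) \<longlonglongrightarrow> time_constant (cdf \<nu>0) (0, 1)}
      \<in> sets (env_measure \<epsilon> \<Otimes>\<^sub>M edge_measure)"
    by measurable
  moreover have "AE \<eta> in env_measure \<epsilon>. AE \<xi> in edge_measure. (\<lambda>n. ?X n (\<eta>, \<xi>)) \<longlonglongrightarrow> time_constant (cdf \<nu>0) (0, 1)"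
  proof -
    have "AE \<eta> in env_measure \<epsilon>. \<forall>L::nat. \<exists>x0. \<forall>j. \<bar>j\<bar> \<le> int L \<longrightarrow> \<eta> (x0 + j)"
      unfolding AE_all_countable using AE_env_measure_run assms(1,2) by blast
    then show ?thesis
    proof eventually_elim
      case (elim \<eta>)
      then show ?case
        using T_env_tendsto[OF \<nu>, of \<eta>] time_constant_eq_path_time_constant[OF \<nu>] by simp
    qed
  qed
  ultimately show ?thesis
    by (rule AE_pair_measure)
qed

end
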